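(* Let $n \geq 3$ be an integer. Then the multiplier algebra $\mathcal{M}(\mathrm{H}^2_n)$ of the Drury-Arveson space $\mathrm{H}^2_n$ on the unit ball of $\mathbb{C}^n$, regarded as a unital commutative ring with pointwise operations, is not coherent.
   Context: Let $\mathbb{B}_n := \{z=(z_1,\dots,z_n)\in\mathbb{C}^n : |z_1|^2+\cdots+|z_n|^2<1\}$. The Drury-Arveson space $\mathrm{H}^2_n$ is the reproducing kernel Hilbert space of holomorphic functions on $\mathbb{B}_n$ with kernel $K(z,w)=\frac{1}{1-\langle z,w\rangle}$, $z,w\in\mathbb{B}_n$, where $\langle z,w\rangle=\sum_{j=1}^n z_j\overline{w_j}$. A holomorphic function $f$ on $\mathbb{B}_n$ is called a multiplier for $\mathrm{H}^2_n$ if $f\cdot \mathrm{H}^2_n\subset \mathrm{H}^2_n$, i.e. $fg\in \mathrm{H}^2_n$ for every $g\in \mathrm{H}^2_n$. $\mathcal{M}(\mathrm{H}^2_n)$ is the ring of all multipliers for $\mathrm{H}^2_n$ with pointwise operations. Coherent ring: let $R$ be a unital commutative ring. For $m\in\mathbb{N}=\{1,2,3,\dots\}$ and $f=(f_1,\dots,f_m)\in R^m$, let $f^\perp := \{(g_1,\dots,g_m)\in R^m : g_1f_1+\cdots+g_mf_m=0\}$, which is an $R$-submodule of $R^m$. The ring $R$ is said to be coherent if for each $m\in\mathbb{N}$ and each $f\in R^m$, the $R$-module $f^\perp$ is finitely generated. *)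

theory Defs
  imports "HOL-Analysis.Analysis" "HOL-Algebra.Module"
begin

section \<open>Coherent rings\<close>

text \<open>The module \<open>R\<^sup>m\<close>; tuples are extensional functions on \<open>{1..m}\<close>. The \<open>mult\<close> and \<open>one\<close>
  fields of the record play no role for a module.\<close>

definition power_module :: "('a, 'c) ring_scheme \<Rightarrow> nat \<Rightarrow> ('a, nat \<Rightarrow> 'a) module" where
  "power_module R m =
     \<lparr>carrier = {1..m} \<rightarrow>\<^sub>E carrier R,
      mult = (\<lambda>g h. \<lambda>i\<in>{1..m}. g i \<otimes>\<^bsub>R\<^esub> h i),
      one = (\<lambda>i\<in>{1..m}. \<one>\<^bsub>R\<^esub>),
      zero = (\<lambda>i\<in>{1..m}. \<zero>\<^bsub>R\<^esub>),
      add = (\<lambda>g h. \<lambda>i\<in>{1..m}. g i \<oplus>\<^bsub>R\<^esub> h i),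
      smult = (\<lambda>r g. \<lambda>i\<in>{1..m}. r \<otimes>\<^bsub>R\<^esub> g i)\<rparr>"

definition perp :: "('a, 'c) ring_scheme \<Rightarrow> nat \<Rightarrow> (nat \<Rightarrow> 'a) \<Rightarrow> (nat \<Rightarrow> 'a) set" where
  "perp R m f = {g \<in> carrier (power_module R m). (\<Oplus>\<^bsub>R\<^esub>i\<in>{1..m}. g i \<otimes>\<^bsub>R\<^esub> f i) = \<zero>\<^bsub>R\<^esub>}"

text \<open>Finite generation of a submodule \<open>N\<close> of \<open>M\<close>.\<close>

definition fin_gen_submodule ::
    "('a, 'c) ring_scheme \<Rightarrow> ('a, 'b, 'd) module_scheme \<Rightarrow> 'b set \<Rightarrow> bool" where
  "fin_gen_submodule R M N \<longleftrightarrow>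
     (\<exists>A. finite A \<and> A \<subseteq> N \<and>
        N = {\<Oplus>\<^bsub>M\<^esub>a\<in>A. c a \<odot>\<^bsub>M\<^esub> a | c. c \<in> A \<rightarrow> carrier R})"

definition coherent_ring :: "('a, 'c) ring_scheme \<Rightarrow> bool" where
  "coherent_ring R \<longleftrightarrow>
     (\<forall>m\<ge>1. \<forall>f \<in> carrier (power_module R m). fin_gen_submodule R (power_module R m) (perp R m f))"

lemma power_module_is_module:
  assumes "cring R"
  shows "Module.module R (power_module R m)"
proof -
  interpret cring R by fact
  show ?thesis
  proof (rule moduleI[OF assms abelian_groupI])
    fix x assume x: "x \<in> carrier (power_module R m)"
    then show "\<exists>y\<in>carrier (power_module R m). y \<oplus>\<^bsub>power_module R m\<^esub> x = \<zero>\<^bsub>power_module R m\<^esub>"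
      by (intro bexI[of _ "\<lambda>i\<in>{1..m}. \<ominus>\<^bsub>R\<^esub> x i"])
         (auto simp: power_module_def PiE_iff l_neg intro!: restrict_ext)
  qed (auto simp: power_module_def PiE_iff fun_eq_iff extensional_def restrict_def
         a_ac m_assoc l_distr r_distr)
qed

lemma perp_is_submodule:
  assumes "cring R" "f \<in> carrier (power_module R m)"
  shows "submodule (perp R m f) R (power_module R m)"
proof -
  interpret cring R by fact
  interpret M: Module.module R "power_module R m" by (rule power_module_is_module) fact
  have f: "f i \<in> carrier R" if "i \<in> {1..m}" for i
    using assms(2) that by (auto simp: power_module_def PiE_iff)
  have car: "g i \<in> carrier R" if "g \<in> carrier (power_module R m)" "i \<in> {1..m}" for g i
    using that by (auto simp: power_module_def PiE_iff)
  have smult: "r \<odot>\<^bsub>power_module R m\<^esub> g \<in> perp R m f" if r: "r \<in> carrier R" and g: "g \<in> perp R m f" for r g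
  proof -
    from g have gc: "g \<in> carrier (power_module R m)"
      and g0: "(\<Oplus>\<^bsub>R\<^esub>i\<in>{1..m}. g i \<otimes>\<^bsub>R\<^esub> f i) = \<zero>\<^bsub>R\<^esub>" by (auto simp: perp_def)
    have "(\<Oplus>\<^bsub>R\<^esub>i\<in>{1..m}. (r \<odot>\<^bsub>power_module R m\<^esub> g) i \<otimes>\<^bsub>R\<^esub> f i) = (\<Oplus>\<^bsub>R\<^esub>i\<in>{1..m}. r \<otimes>\<^bsub>R\<^esub> (g i \<otimes>\<^bsub>R\<^esub> f i))"
      using r car[OF gc] f by (intro finsum_cong') (auto simp: power_module_def m_assoc)
    also have "\<dots> = r \<otimes>\<^bsub>R\<^esub> (\<Oplus>\<^bsub>R\<^esub>i\<in>{1..m}. g i \<otimes>\<^bsub>R\<^esub> f i)"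
      using r car[OF gc] f by (intro finsum_rdistr[symmetric]) auto
    finally show ?thesis using r g0 M.smult_closed[OF r gc] by (simp add: perp_def)
  qed
  have add: "g \<oplus>\<^bsub>power_module R m\<^esub> h \<in> perp R m f" if g: "g \<in> perp R m f" and h: "h \<in> perp R m f" for g h
  proof -
    from g h have gc: "g \<in> carrier (power_module R m)" "h \<in> carrier (power_module R m)"
      and g0: "(\<Oplus>\<^bsub>R\<^esub>i\<in>{1..m}. g i \<otimes>\<^bsub>R\<^esub> f i) = \<zero>\<^bsub>R\<^esub>" "(\<Oplus>\<^bsub>R\<^esub>i\<in>{1..m}. h i \<otimes>\<^bsub>R\<^esub> f i) = \<zero>\<^bsub>R\<^esub>"
      by (auto simp: perp_def)
    have "(\<Oplus>\<^bsub>R\<^esub>i\<in>{1..m}. (g \<oplus>\<^bsub>power_module R m\<^esub> h) i \<otimes>\<^bsub>R\<^esub> f i)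
        = (\<Oplus>\<^bsub>R\<^esub>i\<in>{1..m}. g i \<otimes>\<^bsub>R\<^esub> f i \<oplus>\<^bsub>R\<^esub> h i \<otimes>\<^bsub>R\<^esub> f i)"
      using car[OF gc(1)] car[OF gc(2)] f by (intro finsum_cong') (auto simp: power_module_def l_distr)
    also have "\<dots> = \<zero>\<^bsub>R\<^esub>"
      using g0 car[OF gc(1)] car[OF gc(2)] f by (subst finsum_addf) auto
    finally show ?thesis using M.a_closed[OF gc] by (simp add: perp_def)
  qed
  have "(\<Oplus>\<^bsub>R\<^esub>i\<in>{1..m}. \<zero>\<^bsub>power_module R m\<^esub> i \<otimes>\<^bsub>R\<^esub> f i) = (\<Oplus>\<^bsub>R\<^esub>i\<in>{1..m}. \<zero>\<^bsub>R\<^esub>)"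
    using f by (intro finsum_cong') (auto simp: power_module_def)
  then have zero: "\<zero>\<^bsub>power_module R m\<^esub> \<in> perp R m f"
    by (simp add: perp_def)
  show ?thesis
  proof (rule M.submoduleI)
    fix a assume a: "a \<in> perp R m f"
    then have ac: "a \<in> carrier (power_module R m)" by (simp add: perp_def)
    have "\<ominus>\<^bsub>power_module R m\<^esub> a = (\<ominus>\<^bsub>R\<^esub> \<one>\<^bsub>R\<^esub>) \<odot>\<^bsub>power_module R m\<^esub> a"
      using ac by (simp add: M.smult_l_minus)
    with smult[OF _ a] show "\<ominus>\<^bsub>power_module R m\<^esub> a \<in> perp R m f" by simp
  qed (use zero add smult in \<open>auto simp: perp_def\<close>)
qed


section \<open>Reproducing kernel Hilbert spaces\<close>

text \<open>A complex-valued function on a set \<open>X\<close> is represented by its extension by \<open>0\<close>, so that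
  equality of functions on \<open>X\<close> is equality and sums and products are pointwise.
  The inner product is linear in the first argument, and only its values on \<open>H\<close> matter.
  For given \<open>X\<close> and \<open>K\<close>, the set \<open>H\<close> and the inner product on it are uniquely determined.\<close>

locale rkhs =
  fixes X :: "'x set"
    and K :: "'x \<Rightarrow> 'x \<Rightarrow> complex"
    and H :: "('x \<Rightarrow> complex) set"
    and ip :: "('x \<Rightarrow> complex) \<Rightarrow> ('x \<Rightarrow> complex) \<Rightarrow> complex"
  assumes zero_outside: "f \<in> H \<Longrightarrow> z \<notin> X \<Longrightarrow> f z = 0"
    and zero_mem: "(\<lambda>z. 0) \<in> H"
    and add_mem: "f \<in> H \<Longrightarrow> g \<in> H \<Longrightarrow> (\<lambda>z. f z + g z) \<in> H"
    and scale_mem: "f \<in> H \<Longrightarrow> (\<lambda>z. c * f z) \<in> H"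
    and ip_add: "f \<in> H \<Longrightarrow> g \<in> H \<Longrightarrow> h \<in> H \<Longrightarrow> ip (\<lambda>z. f z + g z) h = ip f h + ip g h"
    and ip_scale: "f \<in> H \<Longrightarrow> h \<in> H \<Longrightarrow> ip (\<lambda>z. c * f z) h = c * ip f h"
    and ip_commute: "f \<in> H \<Longrightarrow> g \<in> H \<Longrightarrow> ip g f = cnj (ip f g)"
    and ip_pos: "f \<in> H \<Longrightarrow> f \<noteq> (\<lambda>z. 0) \<Longrightarrow> 0 < Re (ip f f)"
    and complete:
      "(\<And>i. F i \<in> H) \<Longrightarrow>
       (\<And>e. 0 < e \<Longrightarrow> \<exists>N. \<forall>i\<ge>N. \<forall>j\<ge>N. 
          sqrt (Re (ip (\<lambda>z. F i z - F j z) (\<lambda>z. F i z - F j z))) < e) \<Longrightarrow>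
       \<exists>f\<in>H. (\<lambda>i::nat. sqrt (Re (ip (\<lambda>z. F i z - f z) (\<lambda>z. F i z - f z)))) \<longlonglongrightarrow> 0"
    and kernel_mem: "w \<in> X \<Longrightarrow> (\<lambda>z. if z \<in> X then K z w else 0) \<in> H"
    and reproducing: "f \<in> H \<Longrightarrow> w \<in> X \<Longrightarrow> ip f (\<lambda>z. if z \<in> X then K z w else 0) = f w"


section \<open>The Drury-Arveson space and its multipliers\<close>

text \<open>The norm of \<open>complex ^ 'n\<close> is the Hermitian one, so \<open>ball 0 1\<close> is the open unit ball of
  \<open>\<complex>\<^sup>n\<close> with \<open>n = CARD('n)\<close>.\<close>

lemma mem_unit_ball_iff: "z \<in> ball (0 :: complex ^ 'n) 1 \<longleftrightarrow> (\<Sum>j\<in>UNIV. (cmod (z $ j))\<^sup>2) < 1"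
  by (simp add: norm_vec_def L2_set_def)

text \<open>Holomorphy of functions of several variables on an open set: the real Frechet derivative exists
  at each point and is complex-linear.\<close>

definition holomorphic_vec_on :: "(complex ^ 'n \<Rightarrow> complex) \<Rightarrow> (complex ^ 'n) set \<Rightarrow> bool" where
  "holomorphic_vec_on f U \<longleftrightarrow>
     (\<forall>z\<in>U. \<exists>D. (f has_derivative D) (at z) \<and> (\<forall>c v. D (c *s v) = c * D v))"

definition da_kernel :: "complex ^ 'n \<Rightarrow> complex ^ 'n \<Rightarrow> complex" where
  "da_kernel z w = 1 / (1 - (\<Sum>j\<in>UNIV. z $ j * cnj (w $ j)))"

locale drury_arveson = rkhs "ball 0 1" da_kernel H ip
  for H :: "(complex ^ 'n \<Rightarrow> complex) set" and ip +
  assumes holomorphic: "f \<in> H \<Longrightarrow> holomorphic_vec_on f (ball 0 1)"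

definition multipliers :: "(complex ^ 'n \<Rightarrow> complex) set \<Rightarrow> (complex ^ 'n \<Rightarrow> complex) set" where
  "multipliers H =
     {f. (\<forall>z. z \<notin> ball 0 1 \<longrightarrow> f z = 0) \<and> holomorphic_vec_on f (ball 0 1) \<and>
         (\<forall>g\<in>H. (\<lambda>z. f z * g z) \<in> H)}"

definition multiplier_ring :: "(complex ^ 'n \<Rightarrow> complex) set \<Rightarrow> (complex ^ 'n \<Rightarrow> complex) ring" where
  "multiplier_ring H =
     \<lparr>carrier = multipliers H,
      mult = (\<lambda>f g z. f z * g z),
      one = (\<lambda>z. if z \<in> ball 0 1 then 1 else 0),
      zero = (\<lambda>z. 0),
      add = (\<lambda>f g z. f z + g z)\<rparr>"

lemma holomorphic_vec_on_add:
  assumes "holomorphic_vec_on f U" "holomorphic_vec_on g U"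
  shows "holomorphic_vec_on (\<lambda>z. f z + g z) U"
  unfolding holomorphic_vec_on_def
proof
  fix z assume "z \<in> U"
  with assms obtain D E where
    "(f has_derivative D) (at z)" "\<forall>c v. D (c *s v) = c * D v"
    "(g has_derivative E) (at z)" "\<forall>c v. E (c *s v) = c * E v"
    unfolding holomorphic_vec_on_def by meson
  then show "\<exists>D. ((\<lambda>z. f z + g z) has_derivative D) (at z) \<and> (\<forall>c v. D (c *s v) = c * D v)"
    by (intro exI[of _ "\<lambda>v. D v + E v"]) (auto intro: has_derivative_add simp: algebra_simps)
qed

lemma holomorphic_vec_on_mult:
  assumes "holomorphic_vec_on f U" "holomorphic_vec_on g U"
  shows "holomorphic_vec_on (\<lambda>z. f z * g z) U"
  unfolding holomorphic_vec_on_def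
proof
  fix z assume "z \<in> U"
  with assms obtain D E where
    "(f has_derivative D) (at z)" "\<forall>c v. D (c *s v) = c * D v"
    "(g has_derivative E) (at z)" "\<forall>c v. E (c *s v) = c * E v"
    unfolding holomorphic_vec_on_def by meson
  then show "\<exists>D. ((\<lambda>z. f z * g z) has_derivative D) (at z) \<and> (\<forall>c v. D (c *s v) = c * D v)"
    by (intro exI[of _ "\<lambda>v. f z * E v + D v * g z"] conjI has_derivative_mult)
       (auto simp: algebra_simps)
qed

lemma holomorphic_vec_on_const_ball:
  "holomorphic_vec_on (\<lambda>z. if z \<in> ball 0 1 then k else 0) (ball 0 1)"
  unfolding holomorphic_vec_on_def
proof
  fix z :: "complex ^ 'n" assume "z \<in> ball 0 1"
  then have "((\<lambda>z. if z \<in> ball 0 1 then k else 0) has_derivative (\<lambda>v. 0)) (at z)"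
    by (intro has_derivative_transform_within_open[OF has_derivative_const[of k] open_ball[of 0 1]]) auto
  then show "\<exists>D. ((\<lambda>z. if z \<in> ball 0 1 then k else 0) has_derivative D) (at z)
      \<and> (\<forall>c v. D (c *s v) = c * D v)"
    by (intro exI[of _ "\<lambda>v. 0"]) auto
qed

lemma (in drury_arveson) cring_multiplier_ring: "cring (multiplier_ring H)"
proof -
  have const: "(\<lambda>z. if z \<in> ball 0 1 then k else 0) \<in> multipliers H" for k
  proof -
    have "(\<lambda>z. (if z \<in> ball 0 1 then k else 0) * g z) = (\<lambda>z. k * g z)" if "g \<in> H" for g
      using zero_outside[OF that] by auto
    then show ?thesis
      by (auto simp: multipliers_def holomorphic_vec_on_const_ball[simplified] scale_mem)
  qed
  have add: "(\<lambda>z. f z + g z) \<in> multipliers H" if "f \<in> multipliers H" "g \<in> multipliers H" for f g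
    using that by (auto simp: multipliers_def distrib_right intro: holomorphic_vec_on_add add_mem)
  have mult: "(\<lambda>z. f z * g z) \<in> multipliers H" if "f \<in> multipliers H" "g \<in> multipliers H" for f g
    using that by (auto simp: multipliers_def mult.assoc intro: holomorphic_vec_on_mult)
  have neg: "(\<lambda>z. - f z) \<in> multipliers H" if f: "f \<in> multipliers H" for f
  proof -
    have "(\<lambda>z. (if z \<in> ball 0 1 then -1 else 0) * f z) = (\<lambda>z. - f z)"
      using f by (auto simp: multipliers_def fun_eq_iff)
    with mult[OF const[of "-1"] f] show ?thesis by simp
  qed
  show ?thesis
  proof (rule cringI[OF abelian_groupI comm_monoidI])
    fix f assume "f \<in> carrier (multiplier_ring H)"
    then show "\<exists>g\<in>carrier (multiplier_ring H). g \<oplus>\<^bsub>multiplier_ring H\<^esub> f = \<zero>\<^bsub>multiplier_ring H\<^esub>"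
      by (intro bexI[of _ "\<lambda>z. - f z"]) (auto simp: multiplier_ring_def neg)
  next
    fix f assume "f \<in> carrier (multiplier_ring H)"
    then show "\<one>\<^bsub>multiplier_ring H\<^esub> \<otimes>\<^bsub>multiplier_ring H\<^esub> f = f"
      by (auto simp: multiplier_ring_def multipliers_def fun_eq_iff)
  qed (use const[of 0] const[of 1] in
        \<open>auto simp: multiplier_ring_def algebra_simps intro: add mult\<close>)
qed

end

theory Submission
  imports Defs "HOL-Complex_Analysis.Cauchy_Integral_Formula"
begin

text \<open>
  Let \<open>p\<close>, \<open>q\<close>, \<open>r\<close> be three different coordinates. The module of relations between \<open>z\<^sub>q\<close> and
  \<open>z\<^sub>r\<close>, that is of pairs \<open>(a, b)\<close> of multipliers with \<open>a z\<^sub>q + b z\<^sub>r = 0\<close>, is not finitely generated.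

  In such a pair, \<open>a\<close> vanishes on the disc \<open>D = {w e\<^sub>p}\<close> (\<open>relation_vanishes_on_axis\<close>), so for a
  combination \<open>\<Sum> c\<^sub>i a\<^sub>i\<close> the derivative \<open>\<partial>\<^sub>r\<close> at a point of \<open>D\<close> is \<open>\<Sum> c\<^sub>i \<partial>\<^sub>r a\<^sub>i\<close>
  (\<open>normal_deriv_sum_mult\<close>). The coefficients \<open>c\<^sub>i\<close> are bounded functions (\<open>multiplier_bounded\<close>).
  Thus every relation would have a normal derivative bounded by a constant times
  \<open>\<Sum>\<^sub>i \<bar>\<partial>\<^sub>r a\<^sub>i\<bar>\<close> on \<open>D\<close>, where the \<open>a\<^sub>i\<close> are the first entries of finitely many generators. Two facts
  about the weight \<open>s(w) = (1 - \<bar>w\<bar>\<^sup>2)\<^sup>1\<^sup>/\<^sup>2\<close> contradict this.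

  \<^item> For finitely many \<open>a\<^sub>i\<close> in \<open>H\<close> there are points \<open>w\<close> at which all \<open>s(w) \<bar>\<partial>\<^sub>r a\<^sub>i\<bar>\<close> are as small as
    desired (\<open>small_normal_derivs\<close>). The function \<open>\<partial>\<^sub>r a\<^sub>i\<close> on \<open>D\<close> lies in the Bergman space of the
    disc, whose elements have quadratic means of order \<open>o(1 / s)\<close> on circles.
  \<^item> There are relations with \<open>s(w) \<bar>\<partial>\<^sub>r a\<bar> = 1\<close> at any given \<open>w\<close>, with multiplier norms bounded
    independently of \<open>w\<close>, namely \<open>(z\<^sub>r k, - z\<^sub>q k)\<close> with the normalized kernel \<open>k\<close> at \<open>w e\<^sub>p\<close>: up to
    sign, \<open>z\<^sub>q k\<close> and \<open>z\<^sub>r k\<close> are components of an automorphism of the ball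
    (\<open>coordinate_nkern\<close>).

  Choose points \<open>w\<^sub>n\<close> with \<open>s(w\<^sub>n) \<bar>\<partial>\<^sub>r a\<^sub>i\<bar> \<le> 6\<^sup>-\<^sup>n\<close> for all generators. With suitable signs, the sum of
  the relations belonging to the \<open>w\<^sub>n\<close> with weights \<open>3\<^sup>-\<^sup>n\<close> has \<open>s(w\<^sub>n) \<bar>\<partial>\<^sub>r a\<bar> \<ge> 3\<^sup>-\<^sup>n / 2\<close> for every
  \<open>n\<close> (\<open>sign_choice\<close>), which the generators cannot reach with bounded coefficients. The same
  choice of signs shows that multipliers are bounded.

  Membership in \<open>H\<close> is always checked by Aronszajn's criterion (\<open>mem_criterion\<close>), which rests on the
  representation of bounded functionals (\<open>representation\<close>).
\<close>

section \<open>Geometry of a reproducing kernel Hilbert space\<close>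

context rkhs
begin

definition nrm :: "('x \<Rightarrow> complex) \<Rightarrow> real" where
  "nrm f = sqrt (Re (ip f f))"

definition kern :: "'x \<Rightarrow> 'x \<Rightarrow> complex" where
  "kern w = (\<lambda>z. if z \<in> X then K z w else 0)"

text \<open>The sums over finite sets \<open>S \<subseteq> X\<close> form the span of the kernel functions. Coefficients and
  points are kept apart because the estimates below are about all coefficient families at once.\<close>

definition kspan :: "'x set \<Rightarrow> ('x \<Rightarrow> complex) \<Rightarrow> 'x \<Rightarrow> complex" where
  "kspan S c = (\<lambda>z. \<Sum>x\<in>S. c x * kern x z)"

lemma kern_mem: "w \<in> X \<Longrightarrow> kern w \<in> H"
  unfolding kern_def by (rule kernel_mem)

lemma ip_kern: "f \<in> H \<Longrightarrow> w \<in> X \<Longrightarrow> ip f (kern w) = f w"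
  unfolding kern_def by (rule reproducing)

lemma diff_mem: "f \<in> H \<Longrightarrow> g \<in> H \<Longrightarrow> (\<lambda>z. f z - g z) \<in> H"
  using add_mem[of f "\<lambda>z. (-1) * g z"] scale_mem[of g "-1"] by simp

lemma ip_add_right:
  "f \<in> H \<Longrightarrow> g \<in> H \<Longrightarrow> h \<in> H \<Longrightarrow> ip h (\<lambda>z. f z + g z) = ip h f + ip h g"
  using ip_commute[of "\<lambda>z. f z + g z" h] ip_add[of f g h] ip_commute[of f h] ip_commute[of g h]
  by (simp add: add_mem)

lemma ip_scale_right: "f \<in> H \<Longrightarrow> h \<in> H \<Longrightarrow> ip h (\<lambda>z. c * f z) = cnj c * ip h f"
  using ip_commute[of "\<lambda>z. c * f z" h] ip_scale[of f h c] ip_commute[of f h]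
  by (simp add: scale_mem)

lemma ip_diff_left:
  "f \<in> H \<Longrightarrow> g \<in> H \<Longrightarrow> h \<in> H \<Longrightarrow> ip (\<lambda>z. f z - g z) h = ip f h - ip g h"
  using ip_add[of f "\<lambda>z. (-1) * g z" h] ip_scale[of g h "-1"] scale_mem[of g "-1"] by simp

lemma ip_diff_right:
  "f \<in> H \<Longrightarrow> g \<in> H \<Longrightarrow> h \<in> H \<Longrightarrow> ip h (\<lambda>z. f z - g z) = ip h f - ip h g"
  using ip_add_right[of f "\<lambda>z. (-1) * g z" h] ip_scale_right[of g h "-1"] scale_mem[of g "-1"]
  by simp

lemma ip_zero_left: "h \<in> H \<Longrightarrow> ip (\<lambda>z. 0) h = 0"
  using ip_scale[of "\<lambda>z. 0" h 0] zero_mem by simp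

lemma ip_zero_right: "h \<in> H \<Longrightarrow> ip h (\<lambda>z. 0) = 0"
  using ip_scale_right[of "\<lambda>z. 0" h 0] zero_mem by simp

lemma sum_mem:
  "finite S \<Longrightarrow> (\<And>x. x \<in> S \<Longrightarrow> F x \<in> H) \<Longrightarrow> (\<lambda>z. \<Sum>x\<in>S. c x * F x z) \<in> H"
proof (induction rule: finite_induct)
  case (insert a S)
  then show ?case
    using add_mem[OF scale_mem[of "F a" "c a"], of "\<lambda>z. \<Sum>x\<in>S. c x * F x z"] by simp
qed (simp add: zero_mem)

lemma ip_sum_left:
  "finite S \<Longrightarrow> (\<And>x. x \<in> S \<Longrightarrow> F x \<in> H) \<Longrightarrow> h \<in> H \<Longrightarrow>
   ip (\<lambda>z. \<Sum>x\<in>S. c x * F x z) h = (\<Sum>x\<in>S. c x * ip (F x) h)"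
proof (induction rule: finite_induct)
  case (insert a S)
  then show ?case
    using ip_add[of "\<lambda>z. c a * F a z" "\<lambda>z. \<Sum>x\<in>S. c x * F x z" h]
    by (simp add: scale_mem sum_mem ip_scale)
qed (simp add: ip_zero_left)

lemma ip_sum_right:
  "finite S \<Longrightarrow> (\<And>x. x \<in> S \<Longrightarrow> F x \<in> H) \<Longrightarrow> h \<in> H \<Longrightarrow>
   ip h (\<lambda>z. \<Sum>x\<in>S. c x * F x z) = (\<Sum>x\<in>S. cnj (c x) * ip h (F x))"
  by (subst ip_commute)
     (auto simp: ip_sum_left sum_mem ip_commute[symmetric] intro!: sum.cong)

lemma ip_self: "f \<in> H \<Longrightarrow> ip f f = complex_of_real ((nrm f)\<^sup>2)"
proof -
  assume f: "f \<in> H"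
  have "Im (ip f f) = 0" using ip_commute[OF f f] by (simp add: complex_eq_iff)
  moreover have "Re (ip f f) \<ge> 0"
    using ip_pos[OF f] ip_zero_left[OF f] by (cases "f = (\<lambda>z. 0)") auto
  ultimately show ?thesis by (simp add: nrm_def complex_eq_iff)
qed

lemma nrm_nonneg [simp]: "f \<in> H \<Longrightarrow> 0 \<le> nrm f"
  using ip_pos[of f] ip_zero_left[of f]
  by (cases "f = (\<lambda>z. 0)") (auto simp: nrm_def)

lemma nrm_zero_imp: "f \<in> H \<Longrightarrow> nrm f = 0 \<Longrightarrow> f = (\<lambda>z. 0)"
  using ip_pos[of f] by (auto simp: nrm_def)

text \<open>The expansion behind the Cauchy-Schwarz inequality, the parallelogram law and first variations.\<close>

lemma nrm_add_sq:
  assumes "f \<in> H" "g \<in> H"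
  shows "(nrm (\<lambda>z. f z + c * g z))\<^sup>2 = (nrm f)\<^sup>2 + 2 * Re (c * ip g f) + (cmod c)\<^sup>2 * (nrm g)\<^sup>2"
proof -
  let ?h = "\<lambda>z. f z + c * g z"
  have cg: "(\<lambda>z. c * g z) \<in> H" using assms scale_mem by blast
  have h: "?h \<in> H" using assms cg add_mem by blast
  have "complex_of_real ((nrm ?h)\<^sup>2) = ip ?h ?h" using ip_self[OF h] by simp
  also have "\<dots> = ip f f + cnj c * ip f g + c * ip g f + c * cnj c * ip g g"
    using assms cg h by (simp add: ip_add ip_add_right ip_scale ip_scale_right algebra_simps)
  also have "\<dots> = complex_of_real ((nrm f)\<^sup>2) + cnj (c * ip g f) + c * ip g f
      + complex_of_real ((cmod c)\<^sup>2 * (nrm g)\<^sup>2)"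
    using assms ip_commute[of g f] by (simp add: ip_self complex_norm_square[of c, symmetric])
  finally have "Re (complex_of_real ((nrm ?h)\<^sup>2)) = Re (complex_of_real ((nrm f)\<^sup>2)
      + cnj (c * ip g f) + c * ip g f + complex_of_real ((cmod c)\<^sup>2 * (nrm g)\<^sup>2))" by simp
  then show ?thesis by simp
qed

lemma cauchy_schwarz:
  assumes "f \<in> H" "g \<in> H"
  shows "cmod (ip f g) \<le> nrm f * nrm g"
proof (cases "nrm g = 0")
  case True
  then have "g = (\<lambda>z. 0)" using assms nrm_zero_imp by blast
  then show ?thesis using assms by (simp add: ip_zero_right)
next
  case False
  define N where "N = (nrm g)\<^sup>2"
  have N: "N > 0" using False by (simp add: N_def)
  define c where "c = - ip f g / N"
  have "ip f g * ip g f = complex_of_real ((cmod (ip f g))\<^sup>2)"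
    by (subst ip_commute[OF assms]) (simp only: complex_norm_square)
  then have "c * ip g f = - complex_of_real ((cmod (ip f g))\<^sup>2 / N)"
    by (simp add: c_def)
  then have 1: "Re (c * ip g f) = - ((cmod (ip f g))\<^sup>2 / N)" by simp
  have 2: "(cmod c)\<^sup>2 * N = (cmod (ip f g))\<^sup>2 / N"
    using N by (simp add: c_def norm_divide power_divide power2_eq_square)
  have "0 \<le> (nrm f)\<^sup>2 + 2 * Re (c * ip g f) + (cmod c)\<^sup>2 * (nrm g)\<^sup>2"
    using nrm_add_sq[OF assms, of c] by (metis zero_le_power2)
  then have "(cmod (ip f g))\<^sup>2 / N \<le> (nrm f)\<^sup>2" using 1 2 by (simp add: N_def)
  then have "(cmod (ip f g))\<^sup>2 \<le> (nrm f * nrm g)\<^sup>2"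
    using N by (simp add: divide_le_eq N_def power_mult_distrib)
  then show ?thesis
    using assms by (meson nrm_nonneg mult_nonneg_nonneg power2_le_imp_le)
qed

lemma eval_bound:
  assumes "f \<in> H" "w \<in> X"
  shows "cmod (f w) \<le> nrm f * nrm (kern w)"
  using cauchy_schwarz[OF assms(1) kern_mem[OF assms(2)]] ip_kern[OF assms] by simp

section \<open>Representation of functionals and density of the kernels\<close>

text \<open>A bounded linear functional on a subspace is represented by a vector of the closure of that
  subspace: a minimizing sequence of \<open>\<parallel>v\<parallel>\<^sup>2 - 2 Re y\<close> is Cauchy by the parallelogram law, and the
  first variation at its limit vanishes. The functional is given by its graph \<open>R\<close>; for a span of
  kernels, where a vector may have several families of coefficients, this avoids choosing one.\<close>

lemma representation:
  assumes RH: "\<forall>(v, y) \<in> R. v \<in> H"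
    and R0: "R \<noteq> {}"
    and Radd: "\<forall>(v, y) \<in> R. \<forall>(v', y') \<in> R. \<forall>c. (\<lambda>z. v z + c * v' z, y + c * y') \<in> R"
    and Rbd: "\<forall>(v, y) \<in> R. cmod y \<le> C * nrm v"
  shows "\<exists>g\<in>H. \<exists>V. (\<forall>(v, y) \<in> R. ip v g = y) \<and> (\<forall>n::nat. V n \<in> Domain R) \<and>
           (\<lambda>n. nrm (\<lambda>z. V n z - g z)) \<longlonglongrightarrow> 0"
proof -
  have RH: "v \<in> H" and Rbd: "cmod y \<le> C * nrm v" if "(v, y) \<in> R" for v y
    using that RH Rbd by auto
  have Radd: "(\<lambda>z. v z + c * v' z, y + c * y') \<in> R"
    if "(v, y) \<in> R" "(v', y') \<in> R" for v y v' y' c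
    using that Radd by blast
  define J where "J = (\<lambda>(v, y). (nrm v)\<^sup>2 - 2 * Re y)"
  have Jlow: "- C\<^sup>2 \<le> J p" if p: "p \<in> R" for p
  proof -
    obtain v y where vy: "p = (v, y)" by force
    have "Re y \<le> C * nrm v" using Rbd[of v y] p vy complex_Re_le_cmod[of y] by simp
    moreover have "0 \<le> (nrm v - C)\<^sup>2" by simp
    ultimately show ?thesis by (simp add: J_def vy power2_eq_square algebra_simps)
  qed
  then have bdd: "bdd_below (J ` R)" by (intro bdd_belowI2)
  define d where "d = Inf (J ` R)"
  have dJ: "d \<le> J p" if "p \<in> R" for p
    using that bdd by (simp add: d_def cINF_lower)
  have "\<exists>p\<in>R. J p < d + e" if "e > 0" for e
    using that R0 bdd cInf_lessD[of "J ` R" "d + e"] by (auto simp: d_def)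
  then have "\<exists>P. \<forall>n. P n \<in> R \<and> J (P n) < d + 1 / real (Suc n)"
    by (intro choice allI) (simp add: Bex_def)
  then obtain P where P: "\<And>n. P n \<in> R" "\<And>n. J (P n) < d + 1 / real (Suc n)" by blast
  define V where "V = (\<lambda>n. fst (P n))"
  define Y where "Y = (\<lambda>n. snd (P n))"
  have VY: "(V n, Y n) \<in> R" for n using P(1) by (simp add: V_def Y_def)
  have VH: "V n \<in> H" for n using RH VY by blast
  have JV: "(nrm (V n))\<^sup>2 - 2 * Re (Y n) < d + 1 / real (Suc n)" for n
    using P(2)[of n] by (simp add: J_def V_def Y_def split_beta)
  have vary: "2 * Re (c * (y - ip v (V n))) \<le> 1 / real (Suc n) + (cmod c)\<^sup>2 * (nrm v)\<^sup>2"
    if vy: "(v, y) \<in> R" for v y c n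
    using dJ[OF Radd[OF VY[of n] vy, of c]] JV[of n] nrm_add_sq[OF VH[of n] RH[OF vy], of c]
    by (simp add: J_def algebra_simps)
  have close: "(nrm (\<lambda>z. V n z - V m z))\<^sup>2 \<le> 4 / real (Suc n) + 4 / real (Suc m)" for n m
  proof -
    have 1: "(nrm (\<lambda>z. V n z + (-1) * V m z))\<^sup>2
        = (nrm (V n))\<^sup>2 - 2 * Re (ip (V m) (V n)) + (nrm (V m))\<^sup>2"
      using nrm_add_sq[OF VH[of n] VH[of m], of "-1"] by simp
    \<comment> \<open>The parallelogram law needs the midpoint of two graph elements; it is the sum plus \<open>-1/2\<close> times the sum, the only form of combination that \<open>Radd\<close> offers.\<close>
    have mid: "(\<lambda>z. V n z + 1 * V m z, Y n + 1 * Y m) \<in> R" using Radd VY by blast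
    have half: "(\<lambda>z. (V n z + 1 * V m z) + (-1/2) * (V n z + 1 * V m z),
        (Y n + 1 * Y m) + (-1/2) * (Y n + 1 * Y m)) \<in> R"
      using Radd[OF mid mid, of "-1/2"] by simp
    have s: "(nrm (\<lambda>z. V n z + 1 * V m z))\<^sup>2
        = (nrm (V n))\<^sup>2 + 2 * Re (ip (V m) (V n)) + (nrm (V m))\<^sup>2"
      using nrm_add_sq[OF VH[of n] VH[of m], of 1] by simp
    have q: "(nrm (\<lambda>z. (V n z + 1 * V m z) + (-1/2) * (V n z + 1 * V m z)))\<^sup>2
        = (nrm (\<lambda>z. V n z + 1 * V m z))\<^sup>2 / 4"
      using nrm_add_sq[OF RH[OF mid] RH[OF mid], of "-1/2"] ip_self[OF RH[OF mid]]
      by (simp add: power_divide)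
    have d: "d \<le> (nrm (\<lambda>z. V n z + 1 * V m z))\<^sup>2 / 4 - Re (Y n + Y m)"
      using dJ[OF half] unfolding J_def split q by (simp add: field_simps)
    have 1: "(nrm (\<lambda>z. V n z - V m z))\<^sup>2
        = (nrm (V n))\<^sup>2 - 2 * Re (ip (V m) (V n)) + (nrm (V m))\<^sup>2" using 1 by simp
    have "Re (Y n + Y m) = Re (Y n) + Re (Y m)" by simp
    then have "(nrm (\<lambda>z. V n z - V m z))\<^sup>2 \<le> 4 * (1 / real (Suc n)) + 4 * (1 / real (Suc m))"
      using d 1 s JV[of n] JV[of m] zero_le_divide_1_iff[of "real (Suc n)"]
        zero_le_divide_1_iff[of "real (Suc m)"] by linarith
    then show ?thesis by simp
  qed
  have cau: "\<exists>N. \<forall>i\<ge>N. \<forall>j\<ge>N. 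
          sqrt (Re (ip (\<lambda>z. V i z - V j z) (\<lambda>z. V i z - V j z))) < e" if e: "e > 0" for e
  proof -
    obtain N where N: "8 / e\<^sup>2 < real N" using reals_Archimedean2 by blast
    have "nrm (\<lambda>z. V i z - V j z) < e" if "i \<ge> N" "j \<ge> N" for i j
    proof -
      have "8 < real N * e\<^sup>2" using N e by (simp add: divide_less_eq)
      also have "\<dots> \<le> real (Suc N) * e\<^sup>2" by (intro mult_right_mono) auto
      finally have N': "8 < e\<^sup>2 * real (Suc N)" by (simp add: mult.commute)
      have "4 / real (Suc i) \<le> 4 / real (Suc N)" "4 / real (Suc j) \<le> 4 / real (Suc N)"
        using that by (auto intro!: divide_left_mono)
      then have "(nrm (\<lambda>z. V i z - V j z))\<^sup>2 \<le> 8 / real (Suc N)" using close[of i j] by simp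
      also have "\<dots> < e\<^sup>2" using N' by (simp add: divide_less_eq mult.commute)
      finally show ?thesis using e by (simp add: power2_less_imp_less)
    qed
    then show ?thesis unfolding nrm_def by blast
  qed
  obtain g where g: "g \<in> H" and lim: "(\<lambda>n. nrm (\<lambda>z. V n z - g z)) \<longlonglongrightarrow> 0"
    using complete[OF VH cau] unfolding nrm_def by blast
  have "ip v g = y" if vy: "(v, y) \<in> R" for v y
  proof -
    have vH: "v \<in> H" using RH vy by blast
    have "(\<lambda>n. cmod (ip v (V n) - ip v g)) \<longlonglongrightarrow> 0"
    proof (rule tendsto_sandwich[OF _ _ tendsto_const])
      show "\<forall>\<^sub>F n in sequentially. cmod (ip v (V n) - ip v g) \<le> nrm v * nrm (\<lambda>z. V n z - g z)"
        using cauchy_schwarz[OF vH diff_mem[OF VH g]] ip_diff_right[OF VH g vH] by simp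
      show "(\<lambda>n. nrm v * nrm (\<lambda>z. V n z - g z)) \<longlonglongrightarrow> 0"
        using tendsto_mult_left[OF lim, of "nrm v"] by simp
    qed auto
    then have vlim: "(\<lambda>n. ip v (V n)) \<longlonglongrightarrow> ip v g"
      by (simp add: tendsto_norm_zero_iff LIM_zero_iff)
    define D where "D = y - ip v g"
    have first: "2 * Re (c * D) \<le> (cmod c)\<^sup>2 * (nrm v)\<^sup>2" for c
    proof -
      have "(\<lambda>n. 1 / real (Suc n) + (cmod c)\<^sup>2 * (nrm v)\<^sup>2) \<longlonglongrightarrow> 0 + (cmod c)\<^sup>2 * (nrm v)\<^sup>2"
        by (intro tendsto_intros LIMSEQ_Suc[OF lim_1_over_n])
      moreover have "(\<lambda>n. 2 * Re (c * (y - ip v (V n)))) \<longlonglongrightarrow> 2 * Re (c * D)"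
        unfolding D_def by (intro tendsto_intros vlim)
      ultimately show ?thesis using vary[OF vy, of c]
        by (intro LIMSEQ_le[of "\<lambda>n. 2 * Re (c * (y - ip v (V n)))" _
              "\<lambda>n. 1 / real (Suc n) + (cmod c)\<^sup>2 * (nrm v)\<^sup>2"]) auto
    qed
    \<comment> \<open>A step small enough that the quadratic term does not exceed half of the linear one; the \<open>1\<close> allows for \<open>v = 0\<close>.\<close>
    define t where "t = 1 / (1 + (nrm v)\<^sup>2)"
    have t: "t > 0" "t * (nrm v)\<^sup>2 \<le> 1"
      by (auto simp: t_def add_pos_nonneg divide_le_eq)
    have cD: "complex_of_real t * cnj D * D = complex_of_real (t * (cmod D)\<^sup>2)"
      unfolding of_real_mult complex_norm_square by (simp only: mult_ac)
    have "2 * (t * (cmod D)\<^sup>2) \<le> (cmod (complex_of_real t * cnj D))\<^sup>2 * (nrm v)\<^sup>2"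
      using first[of "complex_of_real t * cnj D"] unfolding cD by simp
    also have "\<dots> = (t * (cmod D)\<^sup>2) * (t * (nrm v)\<^sup>2)"
      using t by (simp add: norm_mult power_mult_distrib power2_eq_square)
    also have "\<dots> \<le> (t * (cmod D)\<^sup>2) * 1"
      using t by (intro mult_left_mono) auto
    finally have "D = 0" using t by (simp add: mult_le_0_iff)
    then show ?thesis by (simp add: D_def)
  qed
  moreover have "V n \<in> Domain R" for n using VY by blast
  ultimately show ?thesis using g lim by (intro bexI[of _ g] exI[of _ V]) auto
qed

lemma kspan_mem: "finite S \<Longrightarrow> S \<subseteq> X \<Longrightarrow> kspan S c \<in> H"
  unfolding kspan_def by (rule sum_mem) (auto intro: kern_mem)

lemma ip_kspan_left:
  "finite S \<Longrightarrow> S \<subseteq> X \<Longrightarrow> f \<in> H \<Longrightarrow> ip (kspan S c) f = (\<Sum>x\<in>S. c x * cnj (f x))"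
  unfolding kspan_def
  by (subst ip_sum_left) (auto simp: kern_mem ip_kern ip_commute[OF _ kern_mem, of f] intro!: sum.cong)

text \<open>Aronszajn's criterion. The estimate says that \<open>kspan S c \<mapsto> \<Sum>x\<in>S. c x * cnj (f x)\<close> is a
  bounded functional on the span of the kernels. A vector that represents it has the values of \<open>f\<close>
  by the reproducing property, and it lies in the closure of that span, which gives the second
  claim.\<close>

lemma mem_criterion:
  assumes f0: "\<And>z. z \<notin> X \<Longrightarrow> f z = 0"
    and bd: "\<And>S c. finite S \<Longrightarrow> S \<subseteq> X \<Longrightarrow> cmod (\<Sum>x\<in>S. c x * cnj (f x)) \<le> C * nrm (kspan S c)"
  shows "f \<in> H"
    and "e > 0 \<Longrightarrow> \<exists>S c. finite S \<and> S \<subseteq> X \<and> nrm (\<lambda>z. kspan S c z - f z) < e"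
proof -
  define R where "R = {(kspan S c, \<Sum>x\<in>S. c x * cnj (f x)) | S c. finite S \<and> S \<subseteq> X}"
  have add: "(\<lambda>z. v z + c * v' z, y + c * y') \<in> R"
    if vy: "(v, y) \<in> R" and vy': "(v', y') \<in> R" for v y v' y' c
  proof -
    obtain S a where S: "finite S" "S \<subseteq> X" "v = kspan S a" "y = (\<Sum>x\<in>S. a x * cnj (f x))"
      using vy by (auto simp: R_def)
    obtain T b where T: "finite T" "T \<subseteq> X" "v' = kspan T b" "y' = (\<Sum>x\<in>T. b x * cnj (f x))"
      using vy' by (auto simp: R_def)
    define a' where "a' = (\<lambda>x. (if x \<in> S then a x else 0) + c * (if x \<in> T then b x else 0))"
    have *: "(\<Sum>x\<in>S. a x * u x) + c * (\<Sum>x\<in>T. b x * u x) = (\<Sum>x\<in>S \<union> T. a' x * u x)" for u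
    proof -
      have "(\<Sum>x\<in>S. a x * u x) = (\<Sum>x\<in>S \<union> T. (if x \<in> S then a x else 0) * u x)"
        using S T by (intro sum.mono_neutral_cong_left) auto
      moreover have "(\<Sum>x\<in>T. b x * u x) = (\<Sum>x\<in>S \<union> T. (if x \<in> T then b x else 0) * u x)"
        using S T by (intro sum.mono_neutral_cong_left) auto
      ultimately show ?thesis
        by (simp add: a'_def sum_distrib_left sum.distrib[symmetric] algebra_simps)
    qed
    have "(\<lambda>z. v z + c * v' z) = kspan (S \<union> T) a'" using * by (simp add: S T kspan_def)
    moreover have "y + c * y' = (\<Sum>x\<in>S \<union> T. a' x * cnj (f x))" using * by (simp add: S T)
    ultimately show ?thesis using S T unfolding R_def by blast
  qed
  have "(kspan {} (\<lambda>x. 0), \<Sum>x\<in>{}. 0 * cnj (f x)) \<in> R" unfolding R_def by blast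
  then have ne: "R \<noteq> {}" by blast
  have RH: "v \<in> H" if "(v, y) \<in> R" for v y
    using that kspan_mem by (auto simp: R_def)
  have Rbd: "cmod y \<le> C * nrm v" if "(v, y) \<in> R" for v y
    using that bd by (auto simp: R_def)
  have "\<exists>g\<in>H. \<exists>V. (\<forall>(v, y) \<in> R. ip v g = y) \<and> (\<forall>n::nat. V n \<in> Domain R) \<and>
           (\<lambda>n. nrm (\<lambda>z. V n z - g z)) \<longlonglongrightarrow> 0"
    by (rule representation[of R C]) (use RH ne add Rbd in auto)
  then obtain g V where gH: "g \<in> H" and gR: "\<forall>(v, y) \<in> R. ip v g = y"
    and VD: "\<forall>n::nat. V n \<in> Domain R" and lim: "(\<lambda>n. nrm (\<lambda>z. V n z - g z)) \<longlonglongrightarrow> 0"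
    by blast
  have g: "ip v g = y" if "(v, y) \<in> R" for v y using gR that by auto
  have "g z = f z" for z
  proof (cases "z \<in> X")
    case True
    have "(kspan {z} (\<lambda>_. 1), \<Sum>x\<in>{z}. 1 * cnj (f x)) \<in> R" using True unfolding R_def by blast
    from g[OF this] have "ip (kern z) g = cnj (f z)" by (simp add: kspan_def)
    moreover have "ip (kern z) g = cnj (g z)"
      using ip_kern[OF gH True] ip_commute[OF gH kern_mem[OF True]] by simp
    ultimately show ?thesis by simp
  next
    case False
    then show ?thesis using f0 zero_outside[OF gH] by simp
  qed
  then have gf: "g = f" by blast
  then show "f \<in> H" using gH by simp
  show "\<exists>S c. finite S \<and> S \<subseteq> X \<and> nrm (\<lambda>z. kspan S c z - f z) < e" if "e > 0"
  proof -
    obtain n where "\<bar>nrm (\<lambda>z. V n z - g z)\<bar> < e"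
      using LIMSEQ_D[OF lim \<open>e > 0\<close>] by auto
    moreover obtain S c where "V n = kspan S c" "finite S" "S \<subseteq> X"
      using VD[rule_format, of n] by (auto simp: R_def)
    ultimately show ?thesis unfolding gf by (intro exI[of _ S] exI[of _ c]) auto
  qed
qed

lemma kspan_dense:
  assumes f: "f \<in> H" and e: "e > 0"
  obtains S c where "finite S" "S \<subseteq> X" "nrm (\<lambda>z. kspan S c z - f z) < e"
proof -
  have bd: "cmod (\<Sum>x\<in>S. c x * cnj (f x)) \<le> nrm f * nrm (kspan S c)"
    if "finite S" "S \<subseteq> X" for S c
    using cauchy_schwarz[OF kspan_mem[OF that] f] ip_kspan_left[OF that f] by (simp add: mult.commute)
  show ?thesis
    using mem_criterion(2)[OF zero_outside[OF f] bd e] that by blast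
qed

lemma riesz:
  assumes add: "\<And>f g c. f \<in> H \<Longrightarrow> g \<in> H \<Longrightarrow> L (\<lambda>z. f z + c * g z) = L f + c * L g"
    and bd: "\<And>f. f \<in> H \<Longrightarrow> cmod (L f) \<le> C * nrm f"
  obtains g where "g \<in> H" "\<And>f. f \<in> H \<Longrightarrow> ip f g = L f"
proof -
  define R where "R = {(f, L f) | f. f \<in> H}"
  have ne: "R \<noteq> {}" using zero_mem by (auto simp: R_def)
  have add': "(\<lambda>z. v z + c * v' z, y + c * y') \<in> R"
    if "(v, y) \<in> R" "(v', y') \<in> R" for v y v' y' c
    using that add add_mem scale_mem by (auto simp: R_def)
  have RH: "v \<in> H" and Rbd: "cmod y \<le> C * nrm v" if "(v, y) \<in> R" for v y
    using that bd by (auto simp: R_def)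
  have "\<exists>g\<in>H. \<exists>V. (\<forall>(v, y) \<in> R. ip v g = y) \<and> (\<forall>n::nat. V n \<in> Domain R) \<and>
           (\<lambda>n. nrm (\<lambda>z. V n z - g z)) \<longlonglongrightarrow> 0"
    by (rule representation[of R C]) (use RH ne add' Rbd in auto)
  then obtain g where g: "g \<in> H" "\<forall>(v, y) \<in> R. ip v g = y"
    by blast
  have "ip f g = L f" if "f \<in> H" for f
    using that g(2) by (auto simp: R_def)
  with g(1) show ?thesis using that by blast
qed

end


section \<open>Series of normalized kernels and boundedness of multipliers\<close>

text \<open>The elementary argument for the uniform boundedness principle: each sign is chosen so that the
  partial sum up to the diagonal entry is not smaller than that entry (one of \<open>A + B\<close>, \<open>A - B\<close> has
  modulus at least \<open>\<bar>B\<bar>\<close>), and with the weights \<open>3\<^sup>-\<^sup>m\<close> the tail takes away at most half of it.\<close>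

lemma sign_choice:
  fixes b :: "nat \<Rightarrow> nat \<Rightarrow> complex"
  assumes le: "\<And>m n. cmod (b m n) \<le> 1" and diag: "\<And>n. cmod (b n n) = 1"
  obtains a :: "nat \<Rightarrow> complex" where "\<And>m. cmod (a m) = (1/3) ^ m"
    "\<And>n. cmod (\<Sum>m. a m * b m n) \<ge> (1/3) ^ n / 2"
proof -
  \<comment> \<open>The choice at stage \<open>n\<close> depends on the earlier ones, so they are collected in a function that is updated at \<open>n\<close>.\<close>
  define nxt :: "nat \<Rightarrow> (nat \<Rightarrow> complex) \<Rightarrow> complex" where
    "nxt = (\<lambda>n E. if cmod ((\<Sum>m<n. E m * b m n) + (1/3) ^ n * b n n) \<ge> (1/3) ^ n
                   then (1/3) ^ n else - ((1/3) ^ n))"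
  define E where "E = rec_nat (\<lambda>_. 0) (\<lambda>n E. E(n := nxt n E))"
  have E_Suc: "E (Suc n) = (E n)(n := nxt n (E n))" for n by (simp add: E_def)
  define a where "a = (\<lambda>n. nxt n (E n))"
  have E_eq: "E n m = a m" if "m < n" for m n
    using that by (induction n) (auto simp: E_Suc a_def less_Suc_eq)
  have a: "a n = nxt n a" for n
  proof -
    have "(\<Sum>m<n. E n m * b m n) = (\<Sum>m<n. a m * b m n)" by (intro sum.cong) (auto simp: E_eq)
    then show ?thesis by (simp add: a_def[of] nxt_def)
  qed
  have norm_a: "cmod (a n) = (1/3) ^ n" for n
    by (subst a) (simp add: nxt_def norm_power norm_divide)
  have head: "(1/3) ^ n \<le> cmod (\<Sum>m<Suc n. a m * b m n)" for n
  proof -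
    define A where "A = (\<Sum>m<n. a m * b m n)"
    define B where "B = (1/3) ^ n * b n n"
    have B: "cmod B = (1/3) ^ n" by (simp add: B_def norm_mult norm_power norm_divide diag)
    have "cmod ((A + B) - (A - B)) \<le> cmod (A + B) + cmod (A - B)" by (rule norm_triangle_ineq4)
    moreover have two: "(A + B) - (A - B) = 2 * B" by simp
    then have "cmod ((A + B) - (A - B)) = 2 * cmod B"
      using norm_mult[of 2 B] by (simp only: two) simp
    ultimately have *: "cmod (A + B) \<ge> (1/3) ^ n \<or> cmod (A - B) \<ge> (1/3) ^ n" using B by linarith
    have "(\<Sum>m<Suc n. a m * b m n) = (if cmod (A + B) \<ge> (1/3) ^ n then A + B else A - B)"
      by (simp add: a[of n] nxt_def A_def[symmetric] B_def)
    then show ?thesis using * by (auto split: if_splits)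
  qed
  have "cmod (\<Sum>m. a m * b m n) \<ge> (1/3) ^ n / 2" for n
  proof -
    have term_le: "cmod (a m * b m n) \<le> (1/3) ^ m" for m
      using mult_left_mono[OF le[of m n], of "(1/3) ^ m"] by (simp add: norm_mult norm_a)
    have geo: "summable (\<lambda>m. (1/3::real) ^ m)" by (rule summable_geometric) simp
    have sm: "summable (\<lambda>m. a m * b m n)"
      using geo term_le by (rule summable_comparison_test'[where N = 0])
    have geo': "(\<lambda>m. (1/3::real) ^ (m + Suc n)) sums ((1/3) ^ n / 2)"
    proof -
      have "(\<lambda>m. (1/3::real) ^ m) sums (1 / (1 - 1/3))" by (rule geometric_sums) simp
      from sums_mult2[OF this, of "(1/3) ^ Suc n"] show ?thesis by (simp add: power_add)
    qed
    have "cmod (\<Sum>m. a (m + Suc n) * b (m + Suc n) n) \<le> (\<Sum>m. (1/3::real) ^ (m + Suc n))"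
      using term_le by (rule norm_suminf_le[OF _ sums_summable[OF geo']])
    then have tail: "cmod (\<Sum>m. a (m + Suc n) * b (m + Suc n) n) \<le> (1/3) ^ n / 2"
      using sums_unique[OF geo'] by simp
    have "(\<Sum>m. a m * b m n) = (\<Sum>m. a (m + Suc n) * b (m + Suc n) n) + (\<Sum>m<Suc n. a m * b m n)"
      by (rule suminf_split_initial_segment[OF sm])
    then show ?thesis
      using head[of n] tail norm_diff_ineq[of "\<Sum>m<Suc n. a m * b m n" "\<Sum>m. a (m + Suc n) * b (m + Suc n) n"]
      by (simp add: add.commute)
  qed
  with norm_a that show ?thesis by blast
qed

context rkhs
begin

text \<open>For \<open>C \<ge> 0\<close> this is \<open>f \<in> H\<close> together with \<open>nrm f \<le> C\<close>, in the form of Aronszajn's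
  criterion. In this form it passes to pointwise convergent series without any argument
  about convergence in \<open>H\<close>.\<close>

definition dominated :: "real \<Rightarrow> ('x \<Rightarrow> complex) \<Rightarrow> bool" where
  "dominated C f \<longleftrightarrow> (\<forall>z. z \<notin> X \<longrightarrow> f z = 0) \<and>
     (\<forall>S c. finite S \<longrightarrow> S \<subseteq> X \<longrightarrow> cmod (\<Sum>x\<in>S. c x * cnj (f x)) \<le> C * nrm (kspan S c))"

lemma dominated_mem: "dominated C f \<Longrightarrow> f \<in> H"
  by (rule mem_criterion(1)[of f C]) (auto simp: dominated_def)

lemma dominated_nrm: "f \<in> H \<Longrightarrow> dominated (nrm f) f"
  unfolding dominated_def
proof safe
  fix S c assume f: "f \<in> H" and S: "finite S" "S \<subseteq> X"
  show "cmod (\<Sum>x\<in>S. c x * cnj (f x)) \<le> nrm f * nrm (kspan S c)"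
    using cauchy_schwarz[OF kspan_mem[OF S] f] ip_kspan_left[OF S f] by (simp add: mult.commute)
qed (rule zero_outside)

lemma dominated_scale:
  assumes "dominated C f"
  shows "dominated (cmod a * C) (\<lambda>z. a * f z)"
  unfolding dominated_def
proof safe
  fix S c assume S: "finite S" "S \<subseteq> X"
  have "(\<Sum>x\<in>S. c x * cnj (a * f x)) = cnj a * (\<Sum>x\<in>S. c x * cnj (f x))"
    by (simp add: sum_distrib_left mult_ac)
  moreover have "cmod (\<Sum>x\<in>S. c x * cnj (f x)) \<le> C * nrm (kspan S c)"
    using assms S by (auto simp: dominated_def)
  ultimately show "cmod (\<Sum>x\<in>S. c x * cnj (a * f x)) \<le> cmod a * C * nrm (kspan S c)"
    by (simp add: norm_mult mult_left_mono mult.assoc)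
qed (use assms in \<open>auto simp: dominated_def\<close>)

lemma dominated_eval:
  assumes "dominated C f" "x \<in> X"
  shows "cmod (f x) \<le> C * nrm (kern x)"
  using assms(1)[unfolded dominated_def, THEN conjunct2, rule_format, of "{x}" "\<lambda>_. 1"] assms(2)
  by (simp add: kspan_def)

lemma dominated_series:
  assumes F: "\<And>m. dominated C (F m)" and a: "\<And>m. cmod (a m) \<le> (1/3) ^ m"
  shows "dominated (C * 3 / 2) (\<lambda>z. \<Sum>m. a m * F m z)"
    and "x \<in> X \<Longrightarrow> summable (\<lambda>m. a m * F m x)"
proof -
  have geo: "(\<lambda>m. (1/3::real) ^ m * c) sums (3 / 2 * c)" for c
  proof -
    have "(\<lambda>m. (1/3::real) ^ m) sums (1 / (1 - 1/3))" by (rule geometric_sums) simp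
    from sums_mult2[OF this, of c] show ?thesis by simp
  qed
  have sm: "summable (\<lambda>m. a m * F m x)" if x: "x \<in> X" for x
  proof (rule summable_comparison_test'[where N = 0, OF sums_summable[OF geo[of "C * nrm (kern x)"]]])
    show "cmod (a m * F m x) \<le> (1/3) ^ m * (C * nrm (kern x))" for m
      unfolding norm_mult by (rule mult_mono[OF a dominated_eval[OF F x]]) auto
  qed
  then show "x \<in> X \<Longrightarrow> summable (\<lambda>m. a m * F m x)" .
  show "dominated (C * 3 / 2) (\<lambda>z. \<Sum>m. a m * F m z)"
    unfolding dominated_def
  proof safe
    fix z assume "z \<notin> X"
    then show "(\<Sum>m. a m * F m z) = 0" using F by (simp add: dominated_def)
  next
    fix S c assume S: "finite S" "S \<subseteq> X"
    have "(\<Sum>x\<in>S. c x * cnj (\<Sum>m. a m * F m x)) = cnj (\<Sum>x\<in>S. (\<Sum>m. cnj (c x) * (a m * F m x)))"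
    proof -
      have "(\<Sum>m. cnj (c x) * (a m * F m x)) = cnj (c x) * (\<Sum>m. a m * F m x)" if "x \<in> S" for x
        using S that by (intro suminf_mult sm) auto
      then show ?thesis by simp
    qed
    also have "(\<Sum>x\<in>S. (\<Sum>m. cnj (c x) * (a m * F m x))) = (\<Sum>m. \<Sum>x\<in>S. cnj (c x) * (a m * F m x))"
      using S sm by (intro suminf_sum[symmetric] summable_mult) auto
    finally have *: "cmod (\<Sum>x\<in>S. c x * cnj (\<Sum>m. a m * F m x))
        = cmod (\<Sum>m. \<Sum>x\<in>S. cnj (c x) * (a m * F m x))" by simp
    have bd: "cmod (\<Sum>x\<in>S. cnj (c x) * (a m * F m x)) \<le> (1/3) ^ m * (C * nrm (kspan S c))" for m
    proof -
      have "(\<Sum>x\<in>S. cnj (c x) * (a m * F m x)) = a m * cnj (\<Sum>x\<in>S. c x * cnj (F m x))"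
        by (simp add: sum_distrib_left mult_ac)
      moreover have "cmod (\<Sum>x\<in>S. c x * cnj (F m x)) \<le> C * nrm (kspan S c)"
        using F[of m] S by (auto simp: dominated_def)
      ultimately show ?thesis
        using mult_mono[OF a[of m], of "cmod (\<Sum>x\<in>S. c x * cnj (F m x))"] 
        by (simp add: norm_mult del: cnj_sum)
    qed
    have "cmod (\<Sum>m. \<Sum>x\<in>S. cnj (c x) * (a m * F m x)) \<le> (\<Sum>m. (1/3) ^ m * (C * nrm (kspan S c)))"
      by (rule norm_suminf_le[OF bd sums_summable[OF geo]])
    then show "cmod (\<Sum>x\<in>S. c x * cnj (\<Sum>m. a m * F m x)) \<le> C * 3 / 2 * nrm (kspan S c)"
      using * sums_unique[OF geo[of "C * nrm (kspan S c)"]] by simp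
  qed
qed

lemma kern_cnj: "x \<in> X \<Longrightarrow> y \<in> X \<Longrightarrow> cnj (kern y x) = kern x y"
  using ip_commute[OF kern_mem kern_mem, of x y] ip_kern[OF kern_mem, of x y] ip_kern[OF kern_mem, of y x]
  by simp

lemma nrm_kern_sq: "x \<in> X \<Longrightarrow> complex_of_real ((nrm (kern x))\<^sup>2) = K x x"
  using ip_self[OF kern_mem, of x] ip_kern[OF kern_mem, of x x] by (simp add: kern_def)

lemma nrm_kspan_sq:
  assumes S: "finite S" "S \<subseteq> X"
  shows "complex_of_real ((nrm (kspan S c))\<^sup>2) = (\<Sum>x\<in>S. \<Sum>y\<in>S. c x * cnj (c y) * kern x y)"
proof -
  have "complex_of_real ((nrm (kspan S c))\<^sup>2) = (\<Sum>x\<in>S. c x * cnj (kspan S c x))"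
    using ip_self[OF kspan_mem[OF S], of c] ip_kspan_left[OF S kspan_mem[OF S], of c c] by simp
  also have "\<dots> = (\<Sum>x\<in>S. \<Sum>y\<in>S. c x * cnj (c y) * kern x y)"
    unfolding kspan_def cnj_sum sum_distrib_left
    using S by (intro sum.cong refl) (auto simp: kern_cnj subset_iff mult_ac)
  finally show ?thesis .
qed

text \<open>If \<open>(1 - \<Sum>\<^sub>j \<phi>\<^sub>j(z) cnj \<phi>\<^sub>j(u)) K(z,u)\<close> has the form \<open>a(z) cnj a(u)\<close>, then the squared norm of
  \<open>\<Sum>\<^sub>x c\<^sub>x K\<^sub>x\<close> is \<open>\<bar>\<Sum>\<^sub>x c\<^sub>x cnj a(x)\<bar>\<^sup>2\<close> plus the sum over \<open>j\<close> of the squared norms of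
  \<open>\<Sum>\<^sub>x c\<^sub>x cnj \<phi>\<^sub>j(x) K\<^sub>x\<close>. Hence the adjoint of each multiplication by \<open>\<phi>\<^sub>i\<close>, which acts on kernels by
  \<open>K\<^sub>x \<mapsto> cnj \<phi>\<^sub>i(x) K\<^sub>x\<close>, is a contraction.\<close>

lemma row_contraction:
  assumes I: "finite I" "i \<in> I"
    and pos: "\<And>z u. z \<in> X \<Longrightarrow> u \<in> X \<Longrightarrow>
       (1 - (\<Sum>j\<in>I. \<phi> j z * cnj (\<phi> j u))) * K z u = a z * cnj (a u)"
    and g: "g \<in> H"
  shows "dominated (nrm g) (\<lambda>z. \<phi> i z * g z)"
  unfolding dominated_def
proof safe
  fix z assume "z \<notin> X"
  then show "\<phi> i z * g z = 0" using zero_outside[OF g] by simp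
next
  fix S c assume S: "finite S" "S \<subseteq> X"
  define k where "k = (\<lambda>j. kspan S (\<lambda>x. c x * cnj (\<phi> j x)))"
  define A where "A = (\<Sum>x\<in>S. c x * cnj (a x))"
  have "complex_of_real ((nrm (kspan S c))\<^sup>2)
      = (\<Sum>x\<in>S. \<Sum>y\<in>S. c x * cnj (c y) * kern x y)" by (rule nrm_kspan_sq[OF S])
  also have "\<dots> = (\<Sum>x\<in>S. \<Sum>y\<in>S. c x * cnj (c y) *
      (a y * cnj (a x) + (\<Sum>j\<in>I. \<phi> j y * cnj (\<phi> j x) * kern x y)))"
  proof (intro sum.cong refl)
    fix x y assume "x \<in> S" "y \<in> S"
    then have "x \<in> X" "y \<in> X" using S by auto
    then have "kern x y = a y * cnj (a x) + (\<Sum>j\<in>I. \<phi> j y * cnj (\<phi> j x)) * kern x y"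
      using pos[of y x] by (simp add: kern_def algebra_simps)
    then show "c x * cnj (c y) * kern x y = c x * cnj (c y) *
      (a y * cnj (a x) + (\<Sum>j\<in>I. \<phi> j y * cnj (\<phi> j x) * kern x y))"
      by (simp add: sum_distrib_right)
  qed
  also have "\<dots> = (\<Sum>x\<in>S. \<Sum>y\<in>S. (c x * cnj (a x)) * cnj (c y * cnj (a y)))
      + (\<Sum>x\<in>S. \<Sum>y\<in>S. \<Sum>j\<in>I. (c x * cnj (\<phi> j x)) * cnj (c y * cnj (\<phi> j y)) * kern x y)"
    by (simp add: distrib_left sum.distrib sum_distrib_left mult_ac)
  also have "(\<Sum>x\<in>S. \<Sum>y\<in>S. (c x * cnj (a x)) * cnj (c y * cnj (a y))) = A * cnj A"
    unfolding A_def cnj_sum sum_product ..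
  also have "(\<Sum>x\<in>S. \<Sum>y\<in>S. \<Sum>j\<in>I. (c x * cnj (\<phi> j x)) * cnj (c y * cnj (\<phi> j y)) * kern x y)
      = (\<Sum>j\<in>I. \<Sum>x\<in>S. \<Sum>y\<in>S. (c x * cnj (\<phi> j x)) * cnj (c y * cnj (\<phi> j y)) * kern x y)"
    by (subst sum.swap[of _ S I], intro sum.cong refl, subst sum.swap[of _ S I], rule refl)
  also have "\<dots> = complex_of_real (\<Sum>j\<in>I. (nrm (k j))\<^sup>2)"
    unfolding of_real_sum k_def by (intro sum.cong refl nrm_kspan_sq[OF S, symmetric])
  also have "A * cnj A = complex_of_real ((cmod A)\<^sup>2)" by (rule complex_norm_square[symmetric])
  finally have "(nrm (kspan S c))\<^sup>2 = (cmod A)\<^sup>2 + (\<Sum>j\<in>I. (nrm (k j))\<^sup>2)"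
    by (simp only: of_real_add[symmetric] of_real_eq_iff)
  moreover have "(nrm (k i))\<^sup>2 \<le> (\<Sum>j\<in>I. (nrm (k j))\<^sup>2)"
    using I by (intro member_le_sum) auto
  ultimately have "(nrm (k i))\<^sup>2 \<le> (nrm (kspan S c))\<^sup>2" by (smt (verit) zero_le_power2)
  then have k: "nrm (k i) \<le> nrm (kspan S c)"
    using nrm_nonneg[OF kspan_mem[OF S]] power2_le_imp_le by blast
  have "(\<Sum>x\<in>S. c x * cnj (\<phi> i x * g x)) = ip (k i) g"
    unfolding k_def using ip_kspan_left[OF S g] by (simp add: mult.assoc)
  then have "cmod (\<Sum>x\<in>S. c x * cnj (\<phi> i x * g x)) \<le> nrm (k i) * nrm g"
    using cauchy_schwarz[OF kspan_mem[OF S] g] by (simp add: k_def)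
  also have "\<dots> \<le> nrm g * nrm (kspan S c)"
    using k mult_left_mono[OF k nrm_nonneg[OF g]] by (simp add: mult.commute)
  finally show "cmod (\<Sum>x\<in>S. c x * cnj (\<phi> i x * g x)) \<le> nrm g * nrm (kspan S c)" .
qed

definition nkern :: "'x \<Rightarrow> 'x \<Rightarrow> complex" where
  "nkern x = (\<lambda>z. inverse (complex_of_real (nrm (kern x))) * kern x z)"

lemma dominated_nkern:
  assumes "x \<in> X" "K x x \<noteq> 0"
  shows "dominated 1 (nkern x)"
proof -
  have "nrm (kern x) \<noteq> 0" using nrm_kern_sq[OF assms(1)] assms(2) by auto
  then show ?thesis
    using dominated_scale[OF dominated_nrm[OF kern_mem[OF assms(1)]], of "inverse (complex_of_real (nrm (kern x)))"]
      nrm_nonneg[OF kern_mem[OF assms(1)]]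
    by (simp add: nkern_def norm_inverse)
qed

text \<open>The value of a function of norm \<open>1\<close> at \<open>x\<close> is at most the norm of the kernel at \<open>x\<close>, and the
  normalized kernel attains this. A single series does so along a whole sequence of points, up to
  the factors \<open>3\<^sup>-\<^sup>n / 2\<close>.\<close>

lemma large_kernel_series:
  assumes x: "\<And>n::nat. x n \<in> X" "\<And>n. K (x n) (x n) \<noteq> 0"
  obtains a where "\<And>m. cmod (a m) \<le> (1/3) ^ m"
    "\<And>n. cmod (\<Sum>m. a m * nkern (x m) (x n)) \<ge> (1/3) ^ n / 2 * nrm (kern (x n))"
proof -
  have nz: "nrm (kern (x n)) > 0" for n
    using nrm_kern_sq[OF x(1)] x(2) nrm_nonneg[OF kern_mem[OF x(1)]] 
    by (metis less_eq_real_def of_real_0 zero_power2)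
  define b where "b = (\<lambda>m n. nkern (x m) (x n) / nrm (kern (x n)))"
  have le: "cmod (b m n) \<le> 1" for m n
    using dominated_eval[OF dominated_nkern[OF x(1) x(2)] x(1), of m n] nz[of n]
    by (simp add: b_def norm_divide divide_le_eq)
  have "b n n = 1" for n
  proof -
    have "kern (x n) (x n) = complex_of_real ((nrm (kern (x n)))\<^sup>2)"
      using nrm_kern_sq[OF x(1)] x(1) by (simp add: kern_def)
    then show ?thesis using nz[of n] by (simp add: b_def nkern_def power2_eq_square)
  qed
  then have diag: "cmod (b n n) = 1" for n by simp
  obtain a where a: "\<And>m. cmod (a m) = (1/3) ^ m" "\<And>n. cmod (\<Sum>m. a m * b m n) \<ge> (1/3) ^ n / 2"
    using sign_choice[of b, OF le diag] by metis
  have "(1/3) ^ n / 2 * nrm (kern (x n)) \<le> cmod (\<Sum>m. a m * nkern (x m) (x n))" for n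
  proof -
    have "summable (\<lambda>m. a m * nkern (x m) (x n))"
      by (rule dominated_series(2)[where C = 1, OF dominated_nkern[OF x] _ x(1)]) (simp add: a)
    from suminf_divide[OF this, of "complex_of_real (nrm (kern (x n)))"]
    have "(\<Sum>m. a m * b m n) = (\<Sum>m. a m * nkern (x m) (x n)) / nrm (kern (x n))"
      by (simp add: b_def)
    then show ?thesis using a(2)[of n] nz[of n] by (simp add: norm_divide le_divide_eq)
  qed
  then show ?thesis using a(1) by (intro that[of a]) auto
qed

text \<open>If \<open>\<bar>f(x\<^sub>n)\<bar> > 6\<^sup>n\<close> at points \<open>x\<^sub>n\<close>, then the product of \<open>f\<close> with a series of kernels that is large
  at all \<open>x\<^sub>n\<close> has values of size \<open>2\<^sup>n\<close> times the norm of the kernel at \<open>x\<^sub>n\<close>, which no element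
  of \<open>H\<close> can have.\<close>

lemma multiplier_bounded:
  assumes pos: "\<And>x. x \<in> X \<Longrightarrow> K x x \<noteq> 0"
    and f: "\<And>g. g \<in> H \<Longrightarrow> (\<lambda>z. f z * g z) \<in> H"
  obtains B where "\<And>x. x \<in> X \<Longrightarrow> cmod (f x) \<le> B"
proof -
  have "\<exists>B. \<forall>x\<in>X. cmod (f x) \<le> B"
  proof (rule ccontr)
    assume "\<nexists>B. \<forall>x\<in>X. cmod (f x) \<le> B"
    then have "\<forall>n. \<exists>x. x \<in> X \<and> cmod (f x) > 6 ^ n" by (meson not_le_imp_less)
    then obtain x where x: "\<And>n::nat. x n \<in> X" "\<And>n. cmod (f (x n)) > 6 ^ n" by metis
    obtain a where a: "\<And>m. cmod (a m) \<le> (1/3) ^ m"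
      "\<And>n. cmod (\<Sum>m. a m * nkern (x m) (x n)) \<ge> (1/3) ^ n / 2 * nrm (kern (x n))"
      using large_kernel_series[of x, OF x(1) pos[OF x(1)]] by metis
    define g where "g = (\<lambda>z. \<Sum>m. a m * nkern (x m) z)"
    have "g \<in> H"
      unfolding g_def
      by (rule dominated_mem[OF dominated_series(1)[where C = 1, OF dominated_nkern[OF x(1) pos[OF x(1)]] a(1)]])
    then have fg: "(\<lambda>z. f z * g z) \<in> H" by (rule f)
    have "2 ^ n \<le> 2 * nrm (\<lambda>z. f z * g z)" for n
    proof -
      have nz: "nrm (kern (x n)) > 0"
        using nrm_kern_sq[OF x(1)] pos[OF x(1)] nrm_nonneg[OF kern_mem[OF x(1)]] 
        by (metis less_eq_real_def of_real_0 zero_power2)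
      have "6 ^ n * ((1/3) ^ n / 2 * nrm (kern (x n))) \<le> cmod (f (x n)) * cmod (g (x n))"
        using x(2)[of n] a(2)[of n] nz unfolding g_def by (intro mult_mono) auto
      also have "\<dots> \<le> nrm (\<lambda>z. f z * g z) * nrm (kern (x n))"
        using eval_bound[OF fg x(1)[of n]] by (simp add: norm_mult)
      finally have "6 ^ n * ((1/3) ^ n / 2) \<le> nrm (\<lambda>z. f z * g z)"
        using nz by (simp add: mult.assoc[symmetric])
      moreover have "(6::real) ^ n * (1/3) ^ n = 2 ^ n" by (simp add: power_mult_distrib[symmetric])
      ultimately show ?thesis by (simp add: mult.assoc[symmetric])
    qed
    moreover obtain n where "2 * nrm (\<lambda>z. f z * g z) < 2 ^ n"
      using real_arch_pow[of 2] by auto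
    ultimately show False by (meson not_less)
  qed
  then show ?thesis using that by blast
qed

end


section \<open>Almost orthogonal families on circles\<close>

text \<open>Bessel's inequality for vectors that are not orthogonal: the Gram matrix has operator norm at
  most its largest row sum (Schur's test).\<close>

lemma (in rkhs) bessel_schur:
  assumes I: "finite I" "\<And>i. i \<in> I \<Longrightarrow> D i \<in> H" and F: "F \<in> H"
    and R: "0 \<le> R" "\<And>i. i \<in> I \<Longrightarrow> (\<Sum>j\<in>I. cmod (ip (D i) (D j))) \<le> R"
  shows "(\<Sum>i\<in>I. (cmod (ip F (D i)))\<^sup>2) \<le> R * (nrm F)\<^sup>2"
proof -
  define a where "a = (\<lambda>i. ip F (D i))"
  define G where "G = (\<lambda>i j. cmod (ip (D i) (D j)))"
  define y where "y = (\<lambda>z. \<Sum>i\<in>I. a i * D i z)"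
  define S where "S = (\<Sum>i\<in>I. (cmod (a i))\<^sup>2)"
  have y: "y \<in> H" unfolding y_def by (rule sum_mem) (use I in auto)
  have S0: "S \<ge> 0" by (simp add: S_def sum_nonneg)
  have G_sym: "G i j = G j i" if "i \<in> I" "j \<in> I" for i j
    using ip_commute[of "D i" "D j"] I that by (simp add: G_def)
  have "ip F y = (\<Sum>i\<in>I. cnj (a i) * a i)"
    unfolding y_def a_def by (rule ip_sum_right) (use I F in auto)
  also have "\<dots> = complex_of_real S"
    unfolding S_def of_real_sum by (intro sum.cong refl) (simp only: complex_norm_square mult.commute)
  finally have "S = cmod (ip F y)" using S0 by simp
  then have SF: "S \<le> nrm F * nrm y" using cauchy_schwarz[OF F y] by simp
  have "complex_of_real ((nrm y)\<^sup>2) = (\<Sum>i\<in>I. a i * ip (D i) y)"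
    unfolding ip_self[OF y, symmetric]
    by (subst (1) y_def, rule ip_sum_left) (use I y in auto)
  also have "\<dots> = (\<Sum>i\<in>I. \<Sum>j\<in>I. a i * (cnj (a j) * ip (D i) (D j)))"
  proof (intro sum.cong refl)
    fix i assume "i \<in> I"
    then have "ip (D i) y = (\<Sum>j\<in>I. cnj (a j) * ip (D i) (D j))"
      unfolding y_def by (intro ip_sum_right) (use I in auto)
    then show "a i * ip (D i) y = (\<Sum>j\<in>I. a i * (cnj (a j) * ip (D i) (D j)))"
      by (simp add: sum_distrib_left)
  qed
  finally have "(nrm y)\<^sup>2 = cmod (\<Sum>i\<in>I. \<Sum>j\<in>I. a i * (cnj (a j) * ip (D i) (D j)))"
    using norm_of_real[of "(nrm y)\<^sup>2"] by (metis abs_power2)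
  also have "\<dots> \<le> (\<Sum>i\<in>I. \<Sum>j\<in>I. cmod (a i) * cmod (a j) * G i j)"
    by (intro order_trans[OF norm_sum] sum_mono) (simp add: norm_mult G_def mult.assoc)
  also have "\<dots> \<le> (\<Sum>i\<in>I. \<Sum>j\<in>I. ((cmod (a i))\<^sup>2 + (cmod (a j))\<^sup>2) / 2 * G i j)"
  proof (intro sum_mono mult_right_mono)
    fix i j
    show "cmod (a i) * cmod (a j) \<le> ((cmod (a i))\<^sup>2 + (cmod (a j))\<^sup>2) / 2"
      using sum_squares_bound[of "cmod (a i)" "cmod (a j)"] by simp
  qed (simp add: G_def)
  also have "\<dots> = (\<Sum>i\<in>I. \<Sum>j\<in>I. (cmod (a i))\<^sup>2 * G i j / 2)
      + (\<Sum>i\<in>I. \<Sum>j\<in>I. (cmod (a j))\<^sup>2 * G i j / 2)"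
    by (simp add: sum.distrib[symmetric] algebra_simps add_divide_distrib)
  also have "(\<Sum>i\<in>I. \<Sum>j\<in>I. (cmod (a j))\<^sup>2 * G i j / 2) = (\<Sum>i\<in>I. \<Sum>j\<in>I. (cmod (a i))\<^sup>2 * G i j / 2)"
    by (subst sum.swap) (intro sum.cong refl, simp add: G_sym)
  also have "(\<Sum>i\<in>I. \<Sum>j\<in>I. (cmod (a i))\<^sup>2 * G i j / 2) + (\<Sum>i\<in>I. \<Sum>j\<in>I. (cmod (a i))\<^sup>2 * G i j / 2)
      = (\<Sum>i\<in>I. (cmod (a i))\<^sup>2 * (\<Sum>j\<in>I. G i j))"
    by (simp only: sum.distrib[symmetric] sum_distrib_left field_sum_of_halves)
  also have "\<dots> \<le> (\<Sum>i\<in>I. (cmod (a i))\<^sup>2 * R)"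
    using R by (intro sum_mono mult_left_mono) (auto simp: G_def)
  finally have yS: "(nrm y)\<^sup>2 \<le> R * S" by (simp add: S_def sum_distrib_left mult.commute)
  have "S * S \<le> (nrm F)\<^sup>2 * (nrm y)\<^sup>2"
    using mult_mono[OF SF SF] S0 F y by (simp add: power2_eq_square mult_ac)
  also have "\<dots> \<le> (nrm F)\<^sup>2 * (R * S)" using yS by (intro mult_left_mono) auto
  finally have SS: "S * S \<le> (R * (nrm F)\<^sup>2) * S" by (simp add: mult_ac)
  have "S \<le> R * (nrm F)\<^sup>2"
  proof (cases "S = 0")
    case True
    then show ?thesis using R(1) by simp
  next
    case False
    then show ?thesis using SS S0 by simp
  qed
  then show ?thesis by (simp add: S_def a_def)
qed

definition unity_root :: "nat \<Rightarrow> nat \<Rightarrow> complex" where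
  "unity_root N k = exp (2 * of_real pi * \<i> * of_nat k / of_nat N)"

lemma norm_unity_root [simp]: "cmod (unity_root N k) = 1"
proof -
  have "2 * of_real pi * \<i> * of_nat k / of_nat N = \<i> * complex_of_real (2 * pi * k / N)" by simp
  then show ?thesis unfolding unity_root_def by (simp only: norm_exp_i_times)
qed

text \<open>For \<open>\<bar>x\<bar> = t\<close> the identity \<open>\<bar>1 - x\<bar>\<^sup>-\<^sup>2 = (2 Re (1 - x)\<^sup>-\<^sup>1 - 1) / (1 - t\<^sup>2)\<close> linearizes the summands (it is the
  Poisson kernel). The sum of \<open>(1 - t u)\<^sup>-\<^sup>1\<close> over the \<open>N\<close>-th roots of unity \<open>u\<close> is
  \<open>N / (1 - t\<^sup>N)\<close>, because \<open>(1 - t u)\<^sup>-\<^sup>1\<close> is \<open>(1 - t\<^sup>N)\<^sup>-\<^sup>1\<close> times a geometric sum of length \<open>N\<close>.\<close>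

lemma sum_unity_root_kernel:
  fixes t :: real
  assumes t: "0 < t" "t < 1" and N: "t ^ N \<le> 1/2" and k: "k < N"
  shows "(\<Sum>l<N. (1 / cmod (1 - t * (unity_root N l * cnj (unity_root N k))))\<^sup>2) \<le> 3 * N / (1 - t)"
proof -
  define u where "u = (\<lambda>l. unity_root N l * cnj (unity_root N k))"
  have N1: "1 \<le> N" using k by simp
  have unity_root_pow: "unity_root N l ^ j = unity_root N j ^ l" for l j
    by (simp add: unity_root_def exp_of_nat_mult[symmetric] mult_ac)
  have unity_root_N: "unity_root N l ^ N = 1" for l
    using complex_root_unity[of N l] N1 by (simp add: unity_root_def)
  have u1: "cmod (u l) = 1" for l by (simp add: u_def norm_mult)
  have uN: "u l ^ N = 1" for l
    by (simp add: u_def power_mult_distrib unity_root_N flip: complex_cnj_power)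
  have usum: "(\<Sum>l<N. u l ^ j) = (if j = 0 then of_nat N else 0)" if j: "j < N" for j
  proof (cases "j = 0")
    case False
    have "unity_root N j \<noteq> 1"
      using complex_root_unity_eq_1[OF N1, of j] False j by (auto simp: unity_root_def dest: dvd_imp_le)
    then have "(\<Sum>l<N. unity_root N j ^ l) = 0" using geometric_sum[of "unity_root N j" N] unity_root_N by simp
    then have "(\<Sum>l<N. unity_root N l ^ j) = 0" by (simp add: unity_root_pow[of _ j])
    then show ?thesis using False
      by (simp add: u_def power_mult_distrib sum_distrib_right[symmetric])
  qed simp
  have ne: "1 - t * u l \<noteq> 0" for l
  proof
    assume "1 - t * u l = 0"
    then have "cmod (t * u l) = 1" by (metis norm_one right_minus_eq)
    then show False using t u1 by (simp add: norm_mult)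
  qed
  have inv: "1 / (1 - t * u l) = (\<Sum>j<N. (t * u l) ^ j) / (1 - t ^ N)" for l
  proof -
    have "t * u l \<noteq> 1" using ne[of l] by auto
    then have "(\<Sum>j<N. (t * u l) ^ j) = ((t * u l) ^ N - 1) / (t * u l - 1)" by (rule geometric_sum)
    also have "(t * u l) ^ N = complex_of_real (t ^ N)" by (simp add: power_mult_distrib uN)
    finally have "(\<Sum>j<N. (t * u l) ^ j) = (1 - complex_of_real (t ^ N)) / (1 - t * u l)"
      by (metis minus_diff_eq minus_divide_divide)
    moreover have "complex_of_real (1 - t ^ N) \<noteq> 0" using N by (simp only: of_real_eq_0_iff)
    ultimately show ?thesis by simp
  qed
  have "(\<Sum>l<N. 1 / (1 - t * u l)) = (\<Sum>j<N. \<Sum>l<N. (t * u l) ^ j) / (1 - t ^ N)"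
    unfolding inv sum_divide_distrib[symmetric] by (subst sum.swap) simp
  also have "(\<Sum>j<N. \<Sum>l<N. (t * u l) ^ j) = (\<Sum>j<N. complex_of_real (t ^ j) * (\<Sum>l<N. u l ^ j))"
    by (simp add: power_mult_distrib sum_distrib_left)
  also have "\<dots> = (\<Sum>j<N. if j = 0 then of_nat N else 0)"
    by (intro sum.cong refl) (simp add: usum)
  also have "\<dots> = of_nat N" using N1 by simp
  finally have tot: "(\<Sum>l<N. 1 / (1 - t * u l)) = complex_of_real (N / (1 - t ^ N))" by simp
  have pt: "(1 / cmod (1 - x))\<^sup>2 = (2 * Re (1 / (1 - x)) - 1) / (1 - t\<^sup>2)" if x: "cmod x = t" "1 - x \<noteq> 0" for x
  proof -
    define n where "n = (cmod (1 - x))\<^sup>2"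
    have n0: "n \<noteq> 0" using x by (simp add: n_def)
    have t2: "1 - t\<^sup>2 \<noteq> 0" using t by (simp add: power2_eq_1_iff)
    have "Re (1 / (1 - x)) = (1 - Re x) / n"
      using Re_divide[of 1 "1 - x"] by (simp add: n_def cmod_power2)
    then have Re_n: "Re (1 / (1 - x)) * n = 1 - Re x" using n0 nonzero_eq_divide_eq by blast
    have "(2 * Re (1 / (1 - x)) - 1) * n = 2 * (Re (1 / (1 - x)) * n) - n"
      by (simp only: left_diff_distrib mult.assoc mult_1)
    also note Re_n
    also have "2 * (1 - Re x) - n = 1 - t\<^sup>2"
      unfolding n_def x(1)[symmetric] cmod_power2 by (simp add: power2_eq_square algebra_simps)
    finally have "2 * Re (1 / (1 - x)) - 1 = (1 - t\<^sup>2) / n"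
      using n0 by (simp add: eq_divide_eq)
    then show ?thesis using t2 n0 by (simp add: n_def power_divide)
  qed
  have "(\<Sum>l<N. (1 / cmod (1 - t * u l))\<^sup>2) = (\<Sum>l<N. (2 * Re (1 / (1 - t * u l)) - 1) / (1 - t\<^sup>2))"
    using t by (intro sum.cong refl pt ne) (simp add: norm_mult u1)
  also have "\<dots> = (2 * Re (\<Sum>l<N. 1 / (1 - t * u l)) - N) / (1 - t\<^sup>2)"
    by (simp add: sum_divide_distrib[symmetric] sum_subtractf sum_distrib_left)
  also have "\<dots> = (2 * (N / (1 - t ^ N)) - N) / (1 - t\<^sup>2)" unfolding tot by simp
  also have "\<dots> \<le> (3 * N) / (1 - t)"
  proof (rule frac_le)
    have "N / (1 - t ^ N) \<le> N / (1/2)" using N by (intro divide_left_mono) auto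
    then show "2 * (N / (1 - t ^ N)) - N \<le> 3 * N" by simp
    show "1 - t \<le> 1 - t\<^sup>2" using t by (simp add: power2_eq_square mult_left_le)
  qed (use t in auto)
  finally show ?thesis by (simp add: u_def)
qed

section \<open>The Drury-Arveson kernel and slices of the ball\<close>

lemma inner_less_one:
  fixes z w :: "complex ^ 'n"
  assumes "norm z < 1" "norm w \<le> 1"
  shows "cmod (\<Sum>j\<in>UNIV. z $ j * cnj (w $ j)) < 1"
proof -
  have "cmod (\<Sum>j\<in>UNIV. z $ j * cnj (w $ j)) \<le> (\<Sum>j\<in>UNIV. \<bar>cmod (z $ j)\<bar> * \<bar>cmod (w $ j)\<bar>)"
    by (intro order_trans[OF norm_sum] sum_mono) (simp add: norm_mult)
  also have "\<dots> \<le> norm z * norm w"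
    unfolding norm_vec_def by (rule L2_set_mult_ineq)
  also have "\<dots> \<le> norm z" using assms by (simp add: mult_left_le)
  finally show ?thesis using assms by simp
qed

lemma da_kernel_axis: "da_kernel z (axis p w) = 1 / (1 - z $ p * cnj w)"
proof -
  have "(\<Sum>j\<in>UNIV. z $ j * cnj (axis p w $ j)) = (\<Sum>j\<in>UNIV. if j = p then z $ p * cnj w else 0)"
    by (intro sum.cong) (auto simp: axis_def)
  then show ?thesis by (simp add: da_kernel_def)
qed

lemma norm_vec_sq: "(norm (x :: complex ^ 'n))\<^sup>2 = (\<Sum>j\<in>UNIV. (cmod (x $ j))\<^sup>2)"
  by (simp add: norm_vec_def L2_set_def sum_nonneg)

lemma norm_axis: "norm (axis p w :: complex ^ 'n) = cmod w"
proof -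
  have "(cmod (axis p w $ j))\<^sup>2 = (if j = p then (cmod w)\<^sup>2 else 0)" for j :: 'n
    by (simp add: axis_def)
  then have "(norm (axis p w :: complex ^ 'n))\<^sup>2 = (cmod w)\<^sup>2"
    unfolding norm_vec_sq by simp
  then show ?thesis by simp
qed

lemma norm_axis_add:
  assumes "p \<noteq> (q :: 'n :: finite)"
  shows "(norm (axis p w + axis q t :: complex ^ 'n))\<^sup>2 = (cmod w)\<^sup>2 + (cmod t)\<^sup>2"
proof -
  have "(cmod ((axis p w + axis q t) $ j))\<^sup>2 = (if j = p then (cmod w)\<^sup>2 else 0) + (if j = q then (cmod t)\<^sup>2 else 0)" for j
    using assms by (auto simp: axis_def)
  then show ?thesis unfolding norm_vec_sq by (simp add: sum.distrib)
qed

lemma da_kernel_self: "da_kernel x x = complex_of_real (1 / (1 - (norm x)\<^sup>2))"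
proof -
  have "(\<Sum>j\<in>UNIV. x $ j * cnj (x $ j)) = complex_of_real ((norm x)\<^sup>2)"
    unfolding norm_vec_sq of_real_sum complex_norm_square ..
  then show ?thesis by (simp add: da_kernel_def)
qed

definition normal_deriv :: "'n \<Rightarrow> 'n \<Rightarrow> (complex ^ 'n \<Rightarrow> complex) \<Rightarrow> complex \<Rightarrow> complex" where
  "normal_deriv p q F w = deriv (\<lambda>t. F (axis p w + axis q t)) 0"

lemma slice_holomorphic:
  fixes F :: "complex ^ 'n \<Rightarrow> complex"
  assumes F: "holomorphic_vec_on F (ball 0 1)" and pq: "p \<noteq> q"
    and w: "(cmod w)\<^sup>2 + \<rho>\<^sup>2 \<le> 1"
  shows "(\<lambda>t. F (axis p w + axis q t)) holomorphic_on ball 0 \<rho>"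
  unfolding holomorphic_on_def
proof
  fix t :: complex assume "t \<in> ball 0 \<rho>"
  then have "cmod t < \<rho>" by simp
  then have "(cmod t)\<^sup>2 < \<rho>\<^sup>2" by (intro power_strict_mono) auto
  then have "(norm (axis p w + axis q t))\<^sup>2 < 1" using w norm_axis_add[OF pq, of w t] by simp
  then have "axis p w + axis q t \<in> ball 0 1" by (simp add: power_less_one_iff abs_square_less_1)
  then obtain D where D: "(F has_derivative D) (at (axis p w + axis q t))" "\<And>c v. D (c *s v) = c * D v"
    using F unfolding holomorphic_vec_on_def by blast
  have lin: "bounded_linear (\<lambda>t::complex. axis q t :: complex ^ 'n)"
    unfolding linear_conv_bounded_linear[symmetric]
    by (rule linearI) (auto simp: vec_eq_iff axis_def)
  have "((\<lambda>t. axis p w + axis q t) has_derivative (\<lambda>s. axis q s)) (at t)"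
    using has_derivative_add[OF has_derivative_const bounded_linear_imp_has_derivative[OF lin]] by simp
  from has_derivative_compose[OF this D(1)]
  have "((\<lambda>t. F (axis p w + axis q t)) has_derivative (\<lambda>s. D (axis q s))) (at t)" .
  moreover have "(\<lambda>s. D (axis q s)) = (*) (D (axis q 1))"
  proof
    fix s
    have "(axis q s :: complex ^ 'n) = s *s axis q 1" by (simp add: vec_eq_iff axis_def)
    then have "D (axis q s) = D (s *s axis q 1)" by (rule arg_cong)
    also have "\<dots> = D (axis q 1) * s" unfolding D(2) by (rule mult.commute)
    finally show "D (axis q s) = D (axis q 1) * s" .
  qed
  ultimately have "((\<lambda>t. F (axis p w + axis q t)) has_field_derivative D (axis q 1)) (at t)"
    by (simp only: has_field_derivative_def)
  then show "(\<lambda>t. F (axis p w + axis q t)) field_differentiable at t within ball 0 \<rho>"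
    using field_differentiable_def field_differentiable_at_within by blast
qed

lemma normal_deriv_has_field_derivative:
  fixes F :: "complex ^ 'n \<Rightarrow> complex"
  assumes F: "holomorphic_vec_on F (ball 0 1)" and pq: "p \<noteq> q" and w: "cmod w < 1"
  shows "((\<lambda>t. F (axis p w + axis q t)) has_field_derivative normal_deriv p q F w) (at 0)"
  unfolding normal_deriv_def
proof (rule holomorphic_derivI[OF slice_holomorphic[OF F pq, of w "sqrt (1 - (cmod w)\<^sup>2)"] open_ball])
  have "(cmod w)\<^sup>2 < 1" using w by (simp add: power_less_one_iff)
  then show "(cmod w)\<^sup>2 + (sqrt (1 - (cmod w)\<^sup>2))\<^sup>2 \<le> 1" "0 \<in> ball 0 (sqrt (1 - (cmod w)\<^sup>2))" by auto
qed

context drury_arveson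
begin

lemma kernel_nonzero: "x \<in> ball (0 :: complex ^ 'n) 1 \<Longrightarrow> da_kernel x x \<noteq> 0"
  by (simp only: da_kernel_self of_real_eq_0_iff)
     (simp add: power2_eq_1_iff, smt (verit) norm_ge_zero)

lemma nrm_kern:
  assumes "norm x < 1"
  shows "nrm (kern x) = 1 / sqrt (1 - (norm x)\<^sup>2)"
proof -
  have "complex_of_real ((nrm (kern x))\<^sup>2) = complex_of_real (1 / (1 - (norm x)\<^sup>2))"
    using nrm_kern_sq[of x] assms by (simp add: da_kernel_self)
  then have "(nrm (kern x))\<^sup>2 = 1 / (1 - (norm x)\<^sup>2)" by (simp only: of_real_eq_iff)
  then have "sqrt ((nrm (kern x))\<^sup>2) = 1 / sqrt (1 - (norm x)\<^sup>2)" by (simp add: real_sqrt_divide)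
  moreover have "nrm (kern x) \<ge> 0" using kern_mem[of x] assms by simp
  ultimately show ?thesis by simp
qed

lemma kern_zero: "kern 0 = (\<lambda>z. if z \<in> ball 0 1 then 1 else 0)"
  by (auto simp: kern_def da_kernel_def fun_eq_iff)

lemma multiplier_mem: "f \<in> multipliers H \<Longrightarrow> g \<in> H \<Longrightarrow> (\<lambda>z. f z * g z) \<in> H"
  by (simp add: multipliers_def)

lemma multiplier_in_H:
  assumes f0: "\<And>z. z \<notin> ball 0 1 \<Longrightarrow> f z = 0" and f: "\<And>g. g \<in> H \<Longrightarrow> (\<lambda>z. f z * g z) \<in> H"
  shows "f \<in> H"
proof -
  have "(\<lambda>z. f z * kern 0 z) = f" using f0 by (auto simp: kern_zero fun_eq_iff)
  then show ?thesis using f[OF kern_mem[of 0]] by simp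
qed

lemma multipliersI:
  assumes "\<And>z. z \<notin> ball 0 1 \<Longrightarrow> f z = 0" "\<And>g. g \<in> H \<Longrightarrow> (\<lambda>z. f z * g z) \<in> H"
  shows "f \<in> multipliers H"
  using assms holomorphic[OF multiplier_in_H[OF assms]] by (simp add: multipliers_def)

lemma multipliers_subset: "multipliers H \<subseteq> H"
  using multiplier_in_H by (auto simp: multipliers_def)

lemma nkern_axis:
  assumes "cmod w < 1" "z \<in> ball 0 1"
  shows "nkern (axis p w) z = sqrt (1 - (cmod w)\<^sup>2) / (1 - z $ p * cnj w)"
  using assms nrm_kern[of "axis p w"] by (simp add: nkern_def norm_axis kern_def da_kernel_axis)

text \<open>The function \<open>z\<^sub>q\<close> times the normalized kernel at the point \<open>w e\<^sub>p\<close> is, up to sign, a component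
  of the automorphism of the ball that exchanges \<open>0\<close> and \<open>w e\<^sub>p\<close>. The components \<open>\<phi>\<^sub>j\<close> of this
  automorphism satisfy
  \<open>1 - \<langle>\<phi>(z), \<phi>(u)\<rangle> = (1 - \<bar>w\<bar>\<^sup>2) (1 - \<langle>z, u\<rangle>) / ((1 - z\<^sub>p cnj w) (1 - w cnj u\<^sub>p))\<close>, so that the
  factor \<open>1 - \<langle>z, u\<rangle>\<close> cancels against the kernel and a rank one form remains.\<close>

lemma coordinate_nkern:
  assumes pq: "p \<noteq> q" and w: "cmod w < 1" and g: "g \<in> H"
  shows "dominated (nrm g) (\<lambda>z. z $ q * nkern (axis p w) z * g z)"
proof -
  define s where "s = sqrt (1 - (cmod w)\<^sup>2)"
  define d where "d = (\<lambda>z :: complex ^ 'n. 1 - z $ p * cnj w)"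
  define \<phi> where "\<phi> = (\<lambda>j z. (if j = p then w - z $ p else s * z $ j) / d z)"
  have "(cmod w)\<^sup>2 \<le> 1" using w by (simp add: power_le_one)
  then have "s * s = 1 - (cmod w)\<^sup>2" by (simp add: s_def)
  then have s: "complex_of_real s * complex_of_real s = 1 - w * cnj w"
    by (metis complex_norm_square of_real_1 of_real_diff of_real_mult)
  then have s2: "complex_of_real (s * s) = 1 - w * cnj w" by simp
  have d: "d z \<noteq> 0" if z: "z \<in> ball 0 1" for z
  proof -
    have "cmod (z $ p) < 1" using z Finite_Cartesian_Product.norm_nth_le[of z p] by simp
    moreover have "cmod (z $ p) * cmod w \<le> cmod (z $ p)" using w by (intro mult_left_le) auto
    ultimately have "cmod (z $ p * cnj w) < 1" by (simp add: norm_mult)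
    then show ?thesis by (auto simp: d_def)
  qed
  have pos: "(1 - (\<Sum>j\<in>UNIV. \<phi> j z * cnj (\<phi> j u))) * da_kernel z u = (s / d z) * cnj (s / d u)"
    if z: "z \<in> ball 0 1" and u: "u \<in> ball 0 1" for z u
  proof -
    define J where "J = (\<Sum>j\<in>UNIV. z $ j * cnj (u $ j))"
    define e where "e = cnj (d u)"
    have e: "e \<noteq> 0" using d[OF u] by (simp add: e_def)
    have "cmod J < 1" unfolding J_def by (rule inner_less_one) (use z u in auto)
    then have J1: "1 - J \<noteq> 0" by auto
    have J: "J = z $ p * cnj (u $ p) + (\<Sum>j\<in>UNIV - {p}. z $ j * cnj (u $ j))"
      unfolding J_def by (rule sum.remove) auto
    have "(\<Sum>j\<in>UNIV. \<phi> j z * cnj (\<phi> j u)) = \<phi> p z * cnj (\<phi> p u) + (\<Sum>j\<in>UNIV - {p}. \<phi> j z * cnj (\<phi> j u))"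
      by (rule sum.remove) auto
    also have "(\<Sum>j\<in>UNIV - {p}. \<phi> j z * cnj (\<phi> j u))
        = (\<Sum>j\<in>UNIV - {p}. (s * s / (d z * e)) * (z $ j * cnj (u $ j)))"
      by (intro sum.cong) (auto simp: \<phi>_def e_def)
    also have "\<dots> = (s * s / (d z * e)) * (J - z $ p * cnj (u $ p))"
      unfolding sum_distrib_left[symmetric] using J by simp
    also have "\<phi> p z * cnj (\<phi> p u) = (w - z $ p) * (cnj w - cnj (u $ p)) / (d z * e)"
      by (simp add: \<phi>_def e_def)
    finally have sum_eq: "(\<Sum>j\<in>UNIV. \<phi> j z * cnj (\<phi> j u)) =
        (w - z $ p) * (cnj w - cnj (u $ p)) / (d z * e) + (s * s / (d z * e)) * (J - z $ p * cnj (u $ p))" .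
    \<comment> \<open>A common denominator \<open>m = d z * e\<close> is cleared in one abstract step.\<close>
    have clear: "(1 - (a / m + (b / m) * c)) * m = m - a - b * c" if "m \<noteq> 0" for a b c m :: complex
      using that by (simp add: left_diff_distrib distrib_right)
    have "(1 - (\<Sum>j\<in>UNIV. \<phi> j z * cnj (\<phi> j u))) * (d z * e)
        = d z * e - (w - z $ p) * (cnj w - cnj (u $ p)) - (s * s) * (J - z $ p * cnj (u $ p))"
      unfolding sum_eq by (rule clear) (use d[OF z] e in simp)
    also have "\<dots> = (s * s) * (1 - J)"
      unfolding s s2 by (simp add: d_def e_def algebra_simps)
    finally have "(1 - (\<Sum>j\<in>UNIV. \<phi> j z * cnj (\<phi> j u))) = (s * s) * (1 - J) / (d z * e)"
      using d[OF z] e by (simp add: eq_divide_eq)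
    then show ?thesis using J1 by (simp add: da_kernel_def J_def[symmetric] e_def)
  qed
  have "dominated (nrm g) (\<lambda>z. \<phi> q z * g z)"
    by (rule row_contraction[where I = UNIV and a = "\<lambda>z. s / d z", OF _ _ pos g]) auto
  moreover have "(\<lambda>z. \<phi> q z * g z) = (\<lambda>z. z $ q * nkern (axis p w) z * g z)"
  proof
    fix z show "\<phi> q z * g z = z $ q * nkern (axis p w) z * g z"
      using zero_outside[OF g, of z] nkern_axis[OF w, of z p] pq
      by (cases "z \<in> ball 0 1") (auto simp: \<phi>_def s_def d_def)
  qed
  ultimately show ?thesis by simp
qed

end


section \<open>Normal derivatives along a coordinate disc\<close>

context drury_arveson
begin

text \<open>The vector that represents the normal derivative at \<open>w e\<^sub>p\<close>. The inner products of these vectors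
  are the values \<open>(1 - v cnj w)\<^sup>-\<^sup>2\<close> of the Bergman kernel of the disc.\<close>

definition dkern :: "'n \<Rightarrow> 'n \<Rightarrow> complex \<Rightarrow> complex ^ 'n \<Rightarrow> complex" where
  "dkern p q w = (\<lambda>z. if z \<in> ball 0 1 then z $ q / (1 - z $ p * cnj w)\<^sup>2 else 0)"

lemma axis_add_mem:
  assumes "p \<noteq> q" "(cmod w)\<^sup>2 + (cmod t)\<^sup>2 < 1"
  shows "(axis p w + axis q t :: complex ^ 'n) \<in> ball 0 1"
proof -
  have "(norm (axis p w + axis q t :: complex ^ 'n))\<^sup>2 < 1"
    using assms norm_axis_add[of p q w t] by simp
  then show ?thesis by (simp add: power_less_one_iff abs_square_less_1)
qed

text \<open>Cauchy's estimate on a circle that stays inside the ball. It makes the normal derivative at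
  \<open>w e\<^sub>p\<close> a bounded functional on \<open>H\<close>, so that a vector represents it.\<close>

lemma normal_deriv_bound:
  assumes F: "F \<in> H" and pq: "p \<noteq> q" and w: "cmod w < 1"
  shows "cmod (normal_deriv p q F w) \<le> 2 / (1 - (cmod w)\<^sup>2) * nrm F"
proof -
  define d where "d = 1 - (cmod w)\<^sup>2"
  have d: "d > 0" using w by (simp add: d_def power_less_one_iff)
  have w_eq: "(cmod w)\<^sup>2 = 1 - d" by (simp add: d_def)
  define r where "r = sqrt (d / 2)"
  have r: "r > 0" "r\<^sup>2 = d / 2" using d by (auto simp: r_def)
  have r': "r < sqrt d" unfolding r_def using d by simp
  have hol: "(\<lambda>t. F (axis p w + axis q t)) holomorphic_on ball 0 (sqrt d)"
    by (rule slice_holomorphic[OF holomorphic[OF F] pq]) (use d in \<open>simp add: d_def\<close>)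
  have "cmod ((deriv ^^ 1) (\<lambda>t. F (axis p w + axis q t)) 0) \<le> fact 1 * (nrm F * (1 / r)) / r ^ 1"
  proof (rule Cauchy_inequality)
    show "(\<lambda>t. F (axis p w + axis q t)) holomorphic_on ball 0 r"
      by (rule holomorphic_on_subset[OF hol]) (use r' in auto)
    show "continuous_on (cball 0 r) (\<lambda>t. F (axis p w + axis q t))"
      by (rule continuous_on_subset[OF holomorphic_on_imp_continuous_on[OF hol]]) (use r' in auto)
    fix t :: complex assume "cmod (0 - t) = r"
    then have t: "(cmod t)\<^sup>2 = d / 2" using r by simp
    let ?x = "axis p w + axis q t"
    have nx: "(norm ?x)\<^sup>2 = 1 - d / 2" using norm_axis_add[OF pq, of w t] t w_eq by simp
    have x: "?x \<in> ball 0 1" by (rule axis_add_mem[OF pq]) (use t d w_eq in simp)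
    have "cmod (F ?x) \<le> nrm F * nrm (kern ?x)" by (rule eval_bound[OF F x])
    also have "nrm (kern ?x) = 1 / r" using nrm_kern[of ?x] x nx by (simp add: r_def)
    finally show "cmod (F ?x) \<le> nrm F * (1 / r)" .
  qed (rule r)
  then have "cmod (normal_deriv p q F w) \<le> nrm F / r\<^sup>2"
    by (simp add: normal_deriv_def power2_eq_square)
  then show ?thesis by (simp add: r(2) d_def field_simps)
qed

lemma normal_deriv_linear:
  assumes F: "F \<in> H" and G: "G \<in> H" and pq: "p \<noteq> q" and w: "cmod w < 1"
  shows "normal_deriv p q (\<lambda>z. F z + c * G z) w = normal_deriv p q F w + c * normal_deriv p q G w"
proof -
  have "((\<lambda>t. F (axis p w + axis q t) + c * G (axis p w + axis q t)) has_field_derivative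
      normal_deriv p q F w + c * normal_deriv p q G w) (at 0)"
    by (intro DERIV_add DERIV_cmult normal_deriv_has_field_derivative holomorphic F G pq w)
  then show ?thesis unfolding normal_deriv_def by (rule DERIV_imp_deriv)
qed

lemma normal_deriv_kern:
  assumes z: "z \<in> ball 0 1" and pq: "p \<noteq> q" and w: "cmod w < 1"
  shows "normal_deriv p q (kern z) w = cnj (dkern p q w z)"
proof -
  define a where "a = 1 - w * cnj (z $ p)"
  have "cmod (z $ p) < 1" using z Finite_Cartesian_Product.norm_nth_le[of z p] by simp
  moreover have "cmod w * cmod (z $ p) \<le> cmod (z $ p)" using w by (intro mult_left_le_one_le) auto
  ultimately have "cmod (w * cnj (z $ p)) < 1" by (simp add: norm_mult)
  then have a: "a \<noteq> 0" by (auto simp: a_def)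
  have val: "kern z (axis p w + axis q t) = 1 / (a - t * cnj (z $ q))"
    if t: "t \<in> ball 0 (sqrt (1 - (cmod w)\<^sup>2))" for t
  proof -
    have "cmod t < sqrt (1 - (cmod w)\<^sup>2)" using t by simp
    then have "(cmod t)\<^sup>2 < (sqrt (1 - (cmod w)\<^sup>2))\<^sup>2" by (intro power_strict_mono) auto
    moreover have "(cmod w)\<^sup>2 \<le> 1" using w by (simp add: power_le_one)
    ultimately have mem: "axis p w + axis q t \<in> ball (0 :: complex ^ 'n) 1"
      by (intro axis_add_mem[OF pq]) simp
    have "(axis p w + axis q t :: complex ^ 'n) $ j * cnj (z $ j)
        = (if j = p then w * cnj (z $ p) else 0) + (if j = q then t * cnj (z $ q) else 0)" for j
      using pq by (auto simp: axis_def)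
    then have "(\<Sum>j\<in>UNIV. (axis p w + axis q t :: complex ^ 'n) $ j * cnj (z $ j))
        = w * cnj (z $ p) + t * cnj (z $ q)"
      by (simp add: sum.distrib)
    then show ?thesis using mem by (simp add: kern_def da_kernel_def a_def algebra_simps)
  qed
  have "((\<lambda>t. 1 / (a - t * cnj (z $ q))) has_field_derivative cnj (z $ q) / a\<^sup>2) (at 0)"
    using a by (auto intro!: derivative_eq_intros simp: power2_eq_square)
  then have "((\<lambda>t. kern z (axis p w + axis q t)) has_field_derivative cnj (z $ q) / a\<^sup>2) (at 0)"
  proof (rule has_field_derivative_transform_within_open[OF _ open_ball])
    have "(cmod w)\<^sup>2 < 1" using w by (simp add: power_less_one_iff)
    then show "0 \<in> ball 0 (sqrt (1 - (cmod w)\<^sup>2))" by simp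
  qed (simp only: val)
  then have "normal_deriv p q (kern z) w = cnj (z $ q) / a\<^sup>2"
    unfolding normal_deriv_def by (rule DERIV_imp_deriv)
  then show ?thesis using z by (simp add: dkern_def a_def mult.commute)
qed

lemma dkern:
  assumes pq: "p \<noteq> q" and w: "cmod w < 1"
  shows dkern_mem: "dkern p q w \<in> H"
    and ip_dkern: "F \<in> H \<Longrightarrow> ip F (dkern p q w) = normal_deriv p q F w"
proof -
  have "\<exists>D\<in>H. \<forall>F\<in>H. ip F D = normal_deriv p q F w"
  proof (rule riesz[of "\<lambda>F. normal_deriv p q F w" "2 / (1 - (cmod w)\<^sup>2)"])
    show "normal_deriv p q (\<lambda>z. f z + c * g z) w = normal_deriv p q f w + c * normal_deriv p q g w"
      if "f \<in> H" "g \<in> H" for f g c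
      by (rule normal_deriv_linear[OF that pq w])
    show "cmod (normal_deriv p q f w) \<le> 2 / (1 - (cmod w)\<^sup>2) * nrm f" if "f \<in> H" for f
      by (rule normal_deriv_bound[OF that pq w])
  qed blast
  then obtain D where D: "D \<in> H" "\<And>F. F \<in> H \<Longrightarrow> ip F D = normal_deriv p q F w" by blast
  have "D = dkern p q w"
  proof
    fix z
    show "D z = dkern p q w z"
    proof (cases "z \<in> ball 0 1")
      case True
      have "D z = cnj (ip (kern z) D)"
        using ip_kern[OF D(1) True] ip_commute[OF D(1) kern_mem[OF True]] by simp
      also have "\<dots> = dkern p q w z"
        using D(2)[OF kern_mem[OF True]] normal_deriv_kern[OF True pq w] by simp
      finally show ?thesis .
    next
      case False
      then show ?thesis using zero_outside[OF D(1)] by (auto simp: dkern_def)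
    qed
  qed
  with D show "dkern p q w \<in> H" "F \<in> H \<Longrightarrow> ip F (dkern p q w) = normal_deriv p q F w" by auto
qed

lemma ip_dkern_dkern:
  assumes pq: "p \<noteq> q" and w: "cmod w < 1" and v: "cmod v < 1"
  shows "ip (dkern p q w) (dkern p q v) = 1 / (1 - v * cnj w)\<^sup>2"
proof -
  have "((\<lambda>t. t * (1 / (1 - v * cnj w)\<^sup>2)) has_field_derivative 1 / (1 - v * cnj w)\<^sup>2) (at 0)"
    using DERIV_cmult_right[OF DERIV_ident, of "1 / (1 - v * cnj w)\<^sup>2" 0] by simp
  then have "((\<lambda>t. dkern p q w (axis p v + axis q t)) has_field_derivative 1 / (1 - v * cnj w)\<^sup>2) (at 0)"
  proof (rule has_field_derivative_transform_within_open[OF _ open_ball])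
    have "(cmod v)\<^sup>2 < 1" using v by (simp add: power_less_one_iff)
    then show "0 \<in> ball 0 (sqrt (1 - (cmod v)\<^sup>2))" by simp
    fix t :: complex assume "t \<in> ball 0 (sqrt (1 - (cmod v)\<^sup>2))"
    then have "cmod t < sqrt (1 - (cmod v)\<^sup>2)" by simp
    then have "(cmod t)\<^sup>2 < (sqrt (1 - (cmod v)\<^sup>2))\<^sup>2" by (intro power_strict_mono) auto
    then have mem: "axis p v + axis q t \<in> ball (0 :: complex ^ 'n) 1"
      using \<open>(cmod v)\<^sup>2 < 1\<close> by (intro axis_add_mem[OF pq]) simp
    then show "t * (1 / (1 - v * cnj w)\<^sup>2) = dkern p q w (axis p v + axis q t)"
      using pq by (simp add: dkern_def axis_def)
  qed
  then have "normal_deriv p q (dkern p q w) v = 1 / (1 - v * cnj w)\<^sup>2"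
    unfolding normal_deriv_def by (rule DERIV_imp_deriv)
  then show ?thesis by (simp add: ip_dkern[OF pq v dkern_mem[OF pq w]])
qed

text \<open>The normal derivatives of \<open>F\<close> on a circle of radius \<open>r\<close> have mean square
  \<open>O((1 - r\<^sup>2)\<^sup>-\<^sup>1)\<close>, whereas a single square can be of order \<open>(1 - r\<^sup>2)\<^sup>-\<^sup>2\<close>: the vectors \<open>dkern\<close> at sufficiently many equidistant
  points are almost orthogonal.\<close>

lemma circle_bound:
  assumes F: "F \<in> H" and pq: "p \<noteq> q" and r: "0 < r" "r < 1" and N: "(r\<^sup>2) ^ N \<le> 1/2"
  shows "(\<Sum>k<N. (cmod (ip F (dkern p q (r * unity_root N k))))\<^sup>2) \<le> 3 * real N / (1 - r\<^sup>2) * (nrm F)\<^sup>2"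
proof (rule bessel_schur[of "{..<N}" "\<lambda>k. dkern p q (r * unity_root N k)" F "3 * real N / (1 - r\<^sup>2)"])
  have r1: "cmod (r * unity_root N k) < 1" for k using r by (simp add: norm_mult)
  show "dkern p q (r * unity_root N k) \<in> H" for k by (rule dkern_mem[OF pq r1])
  have t: "0 < r\<^sup>2" "r\<^sup>2 < 1" using r by (auto simp: power_less_one_iff)
  show "0 \<le> 3 * real N / (1 - r\<^sup>2)" using t by simp
  fix k assume "k \<in> {..<N}"
  then have k: "k < N" by simp
  have "cmod (ip (dkern p q (r * unity_root N k)) (dkern p q (r * unity_root N l)))
      = (1 / cmod (1 - complex_of_real (r\<^sup>2) * (unity_root N l * cnj (unity_root N k))))\<^sup>2" for l
  proof -
    have "r * unity_root N l * cnj (r * unity_root N k) = complex_of_real (r\<^sup>2) * (unity_root N l * cnj (unity_root N k))"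
      by (simp add: power2_eq_square mult_ac)
    then show ?thesis
      unfolding ip_dkern_dkern[OF pq r1 r1] by (simp only: norm_divide norm_power power_divide norm_one power_one)
  qed
  then show "(\<Sum>l<N. cmod (ip (dkern p q (r * unity_root N k)) (dkern p q (r * unity_root N l)))) \<le> 3 * real N / (1 - r\<^sup>2)"
    using sum_unity_root_kernel[OF t N k] by simp
qed (use F in auto)

lemma dkern_kspan_bound:
  assumes S: "finite S" "S \<subseteq> ball 0 1" and pq: "p \<noteq> q"
  obtains B where "B \<ge> 0" "\<And>w. cmod w < 1 \<Longrightarrow> cmod (ip (kspan S c) (dkern p q w)) \<le> B"
proof
  show "0 \<le> (\<Sum>x\<in>S. cmod (c x) * (1 / (1 - norm x)\<^sup>2))" by (intro sum_nonneg) auto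
  fix w assume w: "cmod w < 1"
  have "cmod (ip (kspan S c) (dkern p q w)) \<le> (\<Sum>x\<in>S. cmod (c x * cnj (dkern p q w x)))"
    using ip_kspan_left[OF S dkern_mem[OF pq w], of c] norm_sum by simp
  also have "\<dots> \<le> (\<Sum>x\<in>S. cmod (c x) * (1 / (1 - norm x)\<^sup>2))"
  proof (rule sum_mono)
    fix x assume "x \<in> S"
    then have x: "norm x < 1" using S by auto
    have xp: "cmod (x $ p) \<le> norm x" "cmod (x $ q) \<le> 1"
      using x Finite_Cartesian_Product.norm_nth_le[of x p] Finite_Cartesian_Product.norm_nth_le[of x q] by auto
    have "cmod (x $ p) * cmod w \<le> cmod (x $ p)" using w by (intro mult_left_le) auto
    then have "cmod (x $ p * cnj w) \<le> norm x" using xp by (simp add: norm_mult)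
    then have den: "1 - norm x \<le> cmod (1 - x $ p * cnj w)"
      using norm_triangle_ineq2[of 1 "x $ p * cnj w"] by simp
    have "cmod (x $ q) / (cmod (1 - x $ p * cnj w))\<^sup>2 \<le> 1 / (1 - norm x)\<^sup>2"
      using xp den x by (intro frac_le power_mono) auto
    then show "cmod (c x * cnj (dkern p q w x)) \<le> cmod (c x) * (1 / (1 - norm x)\<^sup>2)"
      using x unfolding norm_mult complex_mod_cnj
      by (intro mult_left_mono) (simp_all add: dkern_def norm_divide norm_power)
  qed
  finally show "cmod (ip (kspan S c) (dkern p q w)) \<le> (\<Sum>x\<in>S. cmod (c x) * (1 / (1 - norm x)\<^sup>2))" .
qed

text \<open>The bound \<open>O\<close> of the mean square improves to \<open>o\<close> by density: a finite combination of kernels has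
  bounded normal derivatives, and the remainder is small in \<open>H\<close>.\<close>

lemma circle_mean_tendsto_zero:
  assumes F: "F \<in> H" and pq: "p \<noteq> q" and e: "e > 0"
  shows "\<forall>\<^sub>F r in at_left 1. \<forall>N. (r\<^sup>2) ^ N \<le> 1/2 \<longrightarrow>
    (1 - r\<^sup>2) * (\<Sum>k<N. (cmod (ip F (dkern p q (r * unity_root N k))))\<^sup>2) \<le> e * N"
proof -
  define \<delta> where "\<delta> = sqrt (e / 12)"
  have \<delta>: "\<delta> > 0" "\<delta>\<^sup>2 = e / 12" using e by (auto simp: \<delta>_def)
  obtain S c where S: "finite S" "S \<subseteq> ball 0 1" "nrm (\<lambda>z. kspan S c z - F z) < \<delta>"
    using kspan_dense[OF F \<delta>(1)] by blast
  define G where "G = kspan S c"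
  have G: "G \<in> H" unfolding G_def by (rule kspan_mem[OF S(1,2)])
  have GF: "(\<lambda>z. G z - F z) \<in> H" by (rule diff_mem[OF G F])
  have GFn: "(nrm (\<lambda>z. G z - F z))\<^sup>2 \<le> e / 12"
    using power_mono[of "nrm (\<lambda>z. G z - F z)" \<delta> 2] S(3) \<delta> nrm_nonneg[OF GF] by (simp add: G_def)
  obtain B where B: "B \<ge> 0" "\<And>w. cmod w < 1 \<Longrightarrow> cmod (ip G (dkern p q w)) \<le> B"
    using dkern_kspan_bound[OF S(1,2) pq, of c] unfolding G_def by blast
  have "((\<lambda>r::real. 2 * B\<^sup>2 * (1 - r\<^sup>2)) \<longlongrightarrow> 2 * B\<^sup>2 * (1 - 1\<^sup>2)) (at_left 1)"
    by (intro tendsto_intros)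
  then have "\<forall>\<^sub>F r in at_left 1. 2 * B\<^sup>2 * (1 - r\<^sup>2) < e / 2"
    using e by (intro order_tendstoD(2)) auto
  moreover have "\<forall>\<^sub>F r in at_left 1. r \<in> {0<..<1::real}"
    by (rule eventually_at_left_real) simp
  ultimately show ?thesis
  proof eventually_elim
    case (elim r)
    then have r: "0 < r" "r < 1" and Br: "2 * B\<^sup>2 * (1 - r\<^sup>2) < e / 2" by auto
    have r2: "r\<^sup>2 < 1" using r by (simp add: power_less_one_iff)
    show ?case
    proof (intro allI impI)
      fix N assume N: "(r\<^sup>2) ^ N \<le> 1/2"
      let ?D = "\<lambda>k. dkern p q (r * unity_root N k)"
      have r1: "cmod (r * unity_root N k) < 1" for k using r by (simp add: norm_mult)
      have pt: "(cmod (ip F (?D k)))\<^sup>2 \<le> 2 * B\<^sup>2 + 2 * (cmod (ip (\<lambda>z. G z - F z) (?D k)))\<^sup>2" for k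
      proof -
        have "cmod (ip F (?D k)) \<le> cmod (ip G (?D k)) + cmod (ip (\<lambda>z. G z - F z) (?D k))"
          using norm_triangle_ineq4[of "ip G (?D k)" "ip (\<lambda>z. G z - F z) (?D k)"]
          by (simp add: ip_diff_left[OF G F dkern_mem[OF pq r1]])
        also have "\<dots> \<le> B + cmod (ip (\<lambda>z. G z - F z) (?D k))" using B(2)[OF r1] by simp
        finally have "(cmod (ip F (?D k)))\<^sup>2 \<le> (B + cmod (ip (\<lambda>z. G z - F z) (?D k)))\<^sup>2"
          by (intro power_mono) auto
        also have "\<dots> \<le> 2 * B\<^sup>2 + 2 * (cmod (ip (\<lambda>z. G z - F z) (?D k)))\<^sup>2"
          using sum_squares_bound[of B "cmod (ip (\<lambda>z. G z - F z) (?D k))"] by (simp add: power2_sum)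
        finally show ?thesis .
      qed
      have "(\<Sum>k<N. (cmod (ip F (?D k)))\<^sup>2)
          \<le> (\<Sum>k<N. 2 * B\<^sup>2 + 2 * (cmod (ip (\<lambda>z. G z - F z) (?D k)))\<^sup>2)"
        by (intro sum_mono pt)
      also have "\<dots> = real N * (2 * B\<^sup>2) + 2 * (\<Sum>k<N. (cmod (ip (\<lambda>z. G z - F z) (?D k)))\<^sup>2)"
        by (simp add: sum.distrib sum_distrib_left)
      also have "\<dots> \<le> real N * (2 * B\<^sup>2) + 2 * (3 * real N / (1 - r\<^sup>2) * (e / 12))"
        using circle_bound[OF GF pq r N] mult_left_mono[OF GFn, of "3 * real N / (1 - r\<^sup>2)"] r2
        by simp
      finally have "(1 - r\<^sup>2) * (\<Sum>k<N. (cmod (ip F (?D k)))\<^sup>2)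
          \<le> (1 - r\<^sup>2) * (real N * (2 * B\<^sup>2) + 2 * (3 * real N / (1 - r\<^sup>2) * (e / 12)))"
        using r2 by (intro mult_left_mono) auto
      also have "\<dots> = (2 * B\<^sup>2 * (1 - r\<^sup>2)) * N + e / 2 * N"
        using r2 by (simp add: field_simps)
      also have "\<dots> \<le> e / 2 * N + e / 2 * N"
        using Br by (intro add_right_mono mult_right_mono) auto
      finally show "(1 - r\<^sup>2) * (\<Sum>k<N. (cmod (ip F (?D k)))\<^sup>2) \<le> e * N" by simp
    qed
  qed
qed

text \<open>Since the mean squares add up over finitely many functions, some point of the circle is good
  for all of them at once.\<close>

lemma small_normal_derivs:
  assumes A: "finite A" "A \<subseteq> H" and pq: "p \<noteq> q" and d: "d > 0"
  obtains w where "cmod w < 1" "\<And>F. F \<in> A \<Longrightarrow> cmod (normal_deriv p q F w) * sqrt (1 - (cmod w)\<^sup>2) \<le> d"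
proof -
  define e where "e = d\<^sup>2 / (card A + 1)"
  have e: "e > 0" using d by (simp add: e_def)
  have "\<forall>\<^sub>F r in at_left 1. \<forall>F\<in>A. \<forall>N. (r\<^sup>2) ^ N \<le> 1/2 \<longrightarrow>
    (1 - r\<^sup>2) * (\<Sum>k<N. (cmod (ip F (dkern p q (r * unity_root N k))))\<^sup>2) \<le> e * N"
    using A pq e by (intro eventually_ball_finite ballI circle_mean_tendsto_zero) auto
  moreover have "\<forall>\<^sub>F r in at_left 1. r \<in> {0<..<1::real}"
    by (rule eventually_at_left_real) simp
  ultimately have "\<forall>\<^sub>F r in at_left 1. r \<in> {0<..<1::real} \<and> (\<forall>F\<in>A. \<forall>N. (r\<^sup>2) ^ N \<le> 1/2 \<longrightarrow>
    (1 - r\<^sup>2) * (\<Sum>k<N. (cmod (ip F (dkern p q (r * unity_root N k))))\<^sup>2) \<le> e * N)"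
    by eventually_elim blast
  from eventually_happens[OF this] obtain r where r: "0 < r" "r < (1::real)"
    and bd: "\<And>F N. F \<in> A \<Longrightarrow> (r\<^sup>2) ^ N \<le> 1/2 \<Longrightarrow>
      (1 - r\<^sup>2) * (\<Sum>k<N. (cmod (ip F (dkern p q (r * unity_root N k))))\<^sup>2) \<le> e * N"
    by (auto simp: trivial_limit_at_left_real)
  have r2: "0 < r\<^sup>2" "r\<^sup>2 < 1" using r by (auto simp: power_less_one_iff)
  obtain N where "(r\<^sup>2) ^ N < 1/2" using real_arch_pow_inv[of "1/2" "r\<^sup>2"] r2 by auto
  then have N: "(r\<^sup>2) ^ N \<le> 1/2" "N > 0" by (auto intro: gr0I)
  define f where "f = (\<lambda>k. \<Sum>F\<in>A. (1 - r\<^sup>2) * (cmod (ip F (dkern p q (r * unity_root N k))))\<^sup>2)"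
  \<comment> \<open>An average over the circle is not below the smallest of its terms.\<close>
  have "(\<Sum>k<N. f k) = (\<Sum>F\<in>A. (1 - r\<^sup>2) * (\<Sum>k<N. (cmod (ip F (dkern p q (r * unity_root N k))))\<^sup>2))"
    unfolding f_def by (subst sum.swap) (simp add: sum_distrib_left)
  also have "\<dots> \<le> (\<Sum>F\<in>A. e * N)" by (intro sum_mono bd N)
  also have "\<dots> = (\<Sum>k<N. card A * e)" by simp
  finally have "\<exists>k<N. f k \<le> card A * e"
    using sum_strict_mono[of "{..<N}" "\<lambda>_. card A * e" f] N by (metis finite_lessThan lessThan_iff lessThan_empty_iff not_less less_numeral_extra(3))
  then obtain k where k: "f k \<le> card A * e" by blast
  define w where "w = complex_of_real r * unity_root N k"
  have cw: "cmod w = r" using r by (simp add: w_def norm_mult)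
  have w: "cmod w < 1" using r cw by simp
  have "cmod (normal_deriv p q F w) * sqrt (1 - (cmod w)\<^sup>2) \<le> d" if F: "F \<in> A" for F
  proof -
    have FH: "F \<in> H" using F A by auto
    have "(cmod (normal_deriv p q F w) * sqrt (1 - (cmod w)\<^sup>2))\<^sup>2 = (1 - r\<^sup>2) * (cmod (ip F (dkern p q w)))\<^sup>2"
      using r2 by (simp add: ip_dkern[OF pq w FH] power_mult_distrib cw)
    also have "\<dots> \<le> f k"
      unfolding f_def w_def using A F r2 by (intro member_le_sum) auto
    also have "\<dots> \<le> (card A + 1) * e" using k e by (simp add: algebra_simps)
    also have "\<dots> = d\<^sup>2" by (simp add: e_def)
    finally show ?thesis by (rule power2_le_imp_le) (use d in simp)
  qed
  with w that show ?thesis by blast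
qed

end


section \<open>Relations between two coordinate functions\<close>

lemma (in drury_arveson) finsum_multiplier_ring:
  assumes "finite S" "\<And>i. i \<in> S \<Longrightarrow> f i \<in> multipliers H"
  shows "finsum (multiplier_ring H) f S = (\<lambda>z. \<Sum>i\<in>S. f i z)"
proof -
  interpret R: cring "multiplier_ring H" by (rule cring_multiplier_ring)
  have carrier: "carrier (multiplier_ring H) = multipliers H" by (simp add: multiplier_ring_def)
  have zero: "\<zero>\<^bsub>multiplier_ring H\<^esub> = (\<lambda>z. 0)" by (simp add: multiplier_ring_def)
  have add: "g \<oplus>\<^bsub>multiplier_ring H\<^esub> h = (\<lambda>z. g z + h z)" for g h by (simp add: multiplier_ring_def)
  show ?thesis using assms
  proof (induction rule: finite_induct)
    case empty
    show ?case by (simp add: zero)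
  next
    case (insert i S)
    have "finsum (multiplier_ring H) f (insert i S) = f i \<oplus>\<^bsub>multiplier_ring H\<^esub> finsum (multiplier_ring H) f S"
      using insert by (intro R.finsum_insert) (auto simp: carrier)
    also have "finsum (multiplier_ring H) f S = (\<lambda>z. \<Sum>i\<in>S. f i z)"
      using insert by (intro insert.IH) auto
    finally show ?case using insert.hyps by (simp add: add)
  qed
qed

lemma (in drury_arveson) finsum_power_module:
  assumes "finite A" "A \<subseteq> carrier (power_module (multiplier_ring H) m)"
    and "\<And>a. a \<in> A \<Longrightarrow> c a \<in> multipliers H" and i: "i \<in> {1..m}"
  shows "finsum (power_module (multiplier_ring H) m) (\<lambda>a. c a \<odot>\<^bsub>power_module (multiplier_ring H) m\<^esub> a) A i
           = (\<lambda>z. \<Sum>a\<in>A. c a z * a i z)"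
proof -
  let ?M = "power_module (multiplier_ring H) m"
  interpret M: Module.module "multiplier_ring H" ?M
    by (rule power_module_is_module[OF cring_multiplier_ring])
  have carrier: "carrier (multiplier_ring H) = multipliers H" by (simp add: multiplier_ring_def)
  have zero: "\<zero>\<^bsub>?M\<^esub> i = (\<lambda>z. 0)" using i by (simp add: power_module_def multiplier_ring_def)
  have add: "(g \<oplus>\<^bsub>?M\<^esub> h) i = (\<lambda>z. g i z + h i z)" for g h
    using i by (simp add: power_module_def multiplier_ring_def)
  have smult: "(f \<odot>\<^bsub>?M\<^esub> g) i = (\<lambda>z. f z * g i z)" for f g
    using i by (simp add: power_module_def multiplier_ring_def)
  show ?thesis using assms(1-3)
  proof (induction rule: finite_induct)
    case empty
    show ?case by (simp add: zero)
  next
    case (insert a A)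
    have "finsum ?M (\<lambda>a. c a \<odot>\<^bsub>?M\<^esub> a) (insert a A) = (c a \<odot>\<^bsub>?M\<^esub> a) \<oplus>\<^bsub>?M\<^esub> finsum ?M (\<lambda>a. c a \<odot>\<^bsub>?M\<^esub> a) A"
      using insert.hyps insert.prems
      by (intro M.finsum_insert) (auto intro!: M.smult_closed simp: carrier)
    moreover have "finsum ?M (\<lambda>a. c a \<odot>\<^bsub>?M\<^esub> a) A i = (\<lambda>z. \<Sum>a\<in>A. c a z * a i z)"
      using insert.prems by (intro insert.IH) auto
    ultimately show ?case using insert.hyps by (simp add: add smult)
  qed
qed

context drury_arveson
begin

definition coord :: "'n \<Rightarrow> complex ^ 'n \<Rightarrow> complex" where
  "coord j = (\<lambda>z. if z \<in> ball 0 1 then z $ j else 0)"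

text \<open>The case \<open>w = 0\<close> of the automorphism components, where the kernel is \<open>1\<close>.\<close>

lemma coord_multiplier:
  assumes pq: "p \<noteq> q"
  shows "coord q \<in> multipliers H"
proof (rule multipliersI)
  fix g assume g: "g \<in> H"
  have "(\<lambda>z. z $ q * nkern (axis p 0) z * g z) \<in> H"
    by (rule dominated_mem[OF coordinate_nkern[OF pq _ g]]) simp
  moreover have "(\<lambda>z. z $ q * nkern (axis p 0) z * g z) = (\<lambda>z. coord q z * g z)"
  proof
    fix z show "z $ q * nkern (axis p 0) z * g z = coord q z * g z"
      using nkern_axis[of 0 z p] zero_outside[OF g, of z] by (cases "z \<in> ball 0 1") (auto simp: coord_def)
  qed
  ultimately show "(\<lambda>z. coord q z * g z) \<in> H" by simp
qed (simp add: coord_def)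

lemma uminus_multiplier:
  assumes "f \<in> multipliers H"
  shows "(\<lambda>z. - f z) \<in> multipliers H"
proof (rule multipliersI)
  fix g assume "g \<in> H"
  then show "(\<lambda>z. - f z * g z) \<in> H"
    using scale_mem[OF multiplier_mem[OF assms], of g "-1"] by simp
qed (use assms in \<open>simp add: multipliers_def\<close>)

text \<open>These functions provide the relations \<open>(z\<^sub>r h, - z\<^sub>q h)\<close> between \<open>z\<^sub>q\<close> and \<open>z\<^sub>r\<close>. The function \<open>h\<close>
  itself need not be a multiplier; multiplying by a coordinate that vanishes on the axis \<open>p\<close> gains
  exactly what is missing.\<close>

lemma kernel_series:
  fixes p :: 'n and w a :: "nat \<Rightarrow> complex"
  assumes w: "\<And>m. cmod (w m) < 1" and a: "\<And>m. cmod (a m) \<le> (1/3) ^ m"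
  defines "h \<equiv> (\<lambda>z. \<Sum>m. a m * nkern (axis p (w m)) z)"
  shows kernel_series_mem: "h \<in> H"
    and coord_kernel_series_multiplier: "p \<noteq> q \<Longrightarrow> (\<lambda>z. coord q z * h z) \<in> multipliers H"
proof -
  have x: "axis p (w m) \<in> ball (0 :: complex ^ 'n) 1" for m using w by (simp add: norm_axis)
  have dom: "dominated 1 (nkern (axis p (w m)))" for m
    by (rule dominated_nkern[OF x kernel_nonzero[OF x]])
  show "h \<in> H" unfolding h_def by (rule dominated_mem[OF dominated_series(1)[OF dom a]])
  assume pq: "p \<noteq> q"
  show "(\<lambda>z. coord q z * h z) \<in> multipliers H"
  proof (rule multipliersI)
    fix g assume g: "g \<in> H"
    have "(\<lambda>z. \<Sum>m. a m * (z $ q * nkern (axis p (w m)) z * g z)) \<in> H"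
      by (rule dominated_mem[OF dominated_series(1)[OF coordinate_nkern[OF pq w g] a]])
    moreover have "(\<lambda>z. \<Sum>m. a m * (z $ q * nkern (axis p (w m)) z * g z)) = (\<lambda>z. coord q z * h z * g z)"
    proof
      fix z show "(\<Sum>m. a m * (z $ q * nkern (axis p (w m)) z * g z)) = coord q z * h z * g z"
      proof (cases "z \<in> ball 0 1")
        case True
        have "summable (\<lambda>m. a m * nkern (axis p (w m)) z)"
          by (rule dominated_series(2)[OF dom a True])
        from suminf_mult[OF this, of "z $ q * g z"]
        have "(\<Sum>m. z $ q * g z * (a m * nkern (axis p (w m)) z)) = z $ q * g z * h z"
          by (simp only: h_def)
        then show ?thesis using True by (simp add: coord_def mult_ac)
      next
        case False
        then show ?thesis using zero_outside[OF g, of z] by simp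
      qed
    qed
    ultimately show "(\<lambda>z. coord q z * h z * g z) \<in> H" by simp
  qed (simp add: coord_def)
qed

lemma axis_add_axis_zero: "axis p w + axis q 0 = (axis p w :: complex ^ 'n)"
  by (simp add: vec_eq_iff axis_def)

text \<open>Near a point of the axis \<open>p\<close>, move in the direction \<open>q\<close>: there \<open>z\<^sub>r = 0\<close> and \<open>z\<^sub>q \<noteq> 0\<close>, so the
  relation forces \<open>a = 0\<close>, and continuity gives the claim. Here three different coordinates are
  used.\<close>

lemma relation_vanishes_on_axis:
  assumes a: "a \<in> H" and pqr: "p \<noteq> q" "p \<noteq> r" "q \<noteq> r" and w: "cmod w < 1"
    and rel: "\<And>z. z \<in> ball 0 1 \<Longrightarrow> a z * z $ q + b z * z $ r = 0"
  shows "a (axis p w) = 0"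
proof -
  let ?f = "\<lambda>t. a (axis p w + axis q t)"
  have "isCont ?f 0"
    by (rule DERIV_isCont[OF normal_deriv_has_field_derivative[OF holomorphic[OF a] pqr(1) w]])
  then have 1: "(?f \<longlongrightarrow> a (axis p w)) (at 0)"
    by (simp add: isCont_def axis_add_axis_zero)
  have w2: "(cmod w)\<^sup>2 < 1" using w by (simp add: power_less_one_iff)
  have "\<forall>\<^sub>F t in at 0. t \<in> ball 0 (sqrt (1 - (cmod w)\<^sup>2)) - {0}"
    by (rule eventually_at_in_open) (use w2 in auto)
  then have "\<forall>\<^sub>F t in at 0. 0 = ?f t"
  proof eventually_elim
    case (elim t)
    then have t: "t \<noteq> 0" "cmod t < sqrt (1 - (cmod w)\<^sup>2)" by auto
    then have "(cmod t)\<^sup>2 < (sqrt (1 - (cmod w)\<^sup>2))\<^sup>2" by (intro power_strict_mono) auto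
    then have mem: "axis p w + axis q t \<in> ball (0 :: complex ^ 'n) 1"
      using w2 by (intro axis_add_mem[OF pqr(1)]) simp
    have "(axis p w + axis q t :: complex ^ 'n) $ q = t" "(axis p w + axis q t :: complex ^ 'n) $ r = 0"
      using pqr by (auto simp: axis_def)
    then have "?f t * t = 0" using rel[OF mem] by simp
    then show ?case using t by simp
  qed
  then have 2: "(?f \<longlongrightarrow> 0) (at 0)" by (rule Lim_transform_eventually[OF tendsto_const])
  show ?thesis by (rule tendsto_unique[OF _ 1 2]) simp
qed

text \<open>Since the \<open>u a\<close> vanish at the point, the product rule leaves only the terms in which the \<open>u a\<close> are
  differentiated; the derivatives of the coefficients disappear.\<close>

lemma normal_deriv_sum_mult:
  assumes A: "finite A" "\<And>a. a \<in> A \<Longrightarrow> c a \<in> H" "\<And>a. a \<in> A \<Longrightarrow> u a \<in> H"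
    and pr: "p \<noteq> r" and w: "cmod w < 1" and u0: "\<And>a. a \<in> A \<Longrightarrow> u a (axis p w) = 0"
  shows "normal_deriv p r (\<lambda>z. \<Sum>a\<in>A. c a z * u a z) w = (\<Sum>a\<in>A. c a (axis p w) * normal_deriv p r (u a) w)"
proof -
  have "((\<lambda>t. \<Sum>a\<in>A. c a (axis p w + axis r t) * u a (axis p w + axis r t)) has_field_derivative
      (\<Sum>a\<in>A. normal_deriv p r (c a) w * u a (axis p w + axis r 0)
         + normal_deriv p r (u a) w * c a (axis p w + axis r 0))) (at 0)"
    by (intro DERIV_sum DERIV_mult normal_deriv_has_field_derivative holomorphic A pr w)
  then have "normal_deriv p r (\<lambda>z. \<Sum>a\<in>A. c a z * u a z) w
      = (\<Sum>a\<in>A. normal_deriv p r (c a) w * u a (axis p w + axis r 0)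
         + normal_deriv p r (u a) w * c a (axis p w + axis r 0))"
    unfolding normal_deriv_def by (rule DERIV_imp_deriv)
  also have "\<dots> = (\<Sum>a\<in>A. c a (axis p w) * normal_deriv p r (u a) w)"
    by (intro sum.cong refl) (simp add: axis_add_axis_zero u0)
  finally show ?thesis .
qed

lemma normal_deriv_coord_mult:
  assumes h: "h \<in> H" and pr: "p \<noteq> r" and w: "cmod w < 1"
  shows "normal_deriv p r (\<lambda>z. coord r z * h z) w = h (axis p w)"
proof -
  have w2: "(cmod w)\<^sup>2 < 1" using w by (simp add: power_less_one_iff)
  have "((\<lambda>t. t * h (axis p w + axis r t)) has_field_derivative
      1 * h (axis p w + axis r 0) + normal_deriv p r h w * 0) (at 0)"
    by (intro DERIV_mult DERIV_ident normal_deriv_has_field_derivative holomorphic h pr w)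
  then have "((\<lambda>t. t * h (axis p w + axis r t)) has_field_derivative h (axis p w)) (at 0)"
    by (simp add: axis_add_axis_zero)
  then have "((\<lambda>t. coord r (axis p w + axis r t) * h (axis p w + axis r t)) has_field_derivative h (axis p w)) (at 0)"
  proof (rule has_field_derivative_transform_within_open[OF _ open_ball])
    show "0 \<in> ball 0 (sqrt (1 - (cmod w)\<^sup>2))" using w2 by simp
    fix t :: complex assume "t \<in> ball 0 (sqrt (1 - (cmod w)\<^sup>2))"
    then have "cmod t < sqrt (1 - (cmod w)\<^sup>2)" by simp
    then have "(cmod t)\<^sup>2 < (sqrt (1 - (cmod w)\<^sup>2))\<^sup>2" by (intro power_strict_mono) auto
    then have mem: "axis p w + axis r t \<in> ball (0 :: complex ^ 'n) 1"
      using w2 by (intro axis_add_mem[OF pr]) simp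
    then show "t * h (axis p w + axis r t) = coord r (axis p w + axis r t) * h (axis p w + axis r t)"
      using pr by (simp add: coord_def axis_def)
  qed
  then show ?thesis unfolding normal_deriv_def by (rule DERIV_imp_deriv)
qed

text \<open>Along points \<open>w\<^sub>n e\<^sub>p\<close> at which the generators have normal derivatives of size \<open>6\<^sup>-\<^sup>n / s\<^sub>n\<close>, where
  \<open>s\<^sub>n = (1 - \<bar>w\<^sub>n\<bar>\<^sup>2)\<^sup>1\<^sup>/\<^sup>2\<close>, there is a relation whose normal derivative has size at least
  \<open>3\<^sup>-\<^sup>n / (2 s\<^sub>n)\<close>. Bounded coefficients cannot make up for the quotient \<open>2\<^sup>n / 2\<close>.\<close>

lemma perp_coord_not_fin_gen:
  fixes p q r :: 'n
  assumes pqr: "p \<noteq> q" "p \<noteq> r" "q \<noteq> r"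
  defines "f \<equiv> (\<lambda>i\<in>{1..2}. if i = 1 then coord q else coord r)"
  shows "\<not> fin_gen_submodule (multiplier_ring H) (power_module (multiplier_ring H) 2)
           (perp (multiplier_ring H) 2 f)"
proof
  let ?R = "multiplier_ring H" and ?M = "power_module (multiplier_ring H) 2"
  have carrier: "carrier ?R = multipliers H" by (simp add: multiplier_ring_def)
  have mult: "u \<otimes>\<^bsub>?R\<^esub> v = (\<lambda>z. u z * v z)" for u v by (simp add: multiplier_ring_def)
  have zero: "\<zero>\<^bsub>?R\<^esub> = (\<lambda>z. 0)" by (simp add: multiplier_ring_def)
  interpret R: cring ?R by (rule cring_multiplier_ring)
  have M_carrier: "g \<in> carrier ?M \<longleftrightarrow> g \<in> extensional {1..2} \<and> g 1 \<in> multipliers H \<and> g 2 \<in> multipliers H" for g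
    by (auto simp: power_module_def PiE_iff carrier) (metis One_nat_def Suc_1 le_SucE le_antisym)
  have f12: "f 1 = coord q" "f 2 = coord r" by (auto simp: f_def)
  have coord: "coord q \<in> multipliers H" "coord r \<in> multipliers H"
    using coord_multiplier pqr by blast+
  have perp: "g \<in> perp ?R 2 f \<longleftrightarrow> g \<in> carrier ?M \<and> (\<forall>z. g 1 z * coord q z + g 2 z * coord r z = 0)" for g
  proof -
    have "(\<Oplus>\<^bsub>?R\<^esub>i\<in>{1..2}. g i \<otimes>\<^bsub>?R\<^esub> f i) = (\<lambda>z. g 1 z * coord q z + g 2 z * coord r z)"
      if g: "g \<in> carrier ?M"
    proof -
      have *: "{1..2} = {1, 2::nat}" by auto
      have "g i \<otimes>\<^bsub>?R\<^esub> f i \<in> multipliers H" if "i \<in> {1..2}" for i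
        using R.m_closed[of "g i" "f i"] that g coord
        unfolding * by (auto simp: carrier M_carrier f12 simp del: One_nat_def)
      then have "(\<Oplus>\<^bsub>?R\<^esub>i\<in>{1..2}. g i \<otimes>\<^bsub>?R\<^esub> f i) = (\<lambda>z. \<Sum>i\<in>{1..2}. (g i \<otimes>\<^bsub>?R\<^esub> f i) z)"
        by (rule finsum_multiplier_ring[OF finite_atLeastAtMost])
      then show ?thesis unfolding * by (simp add: mult f12 del: One_nat_def)
    qed
    then show ?thesis by (auto simp: perp_def zero fun_eq_iff)
  qed
  assume "fin_gen_submodule ?R ?M (perp ?R 2 f)"
  then obtain A where A: "finite A" "A \<subseteq> perp ?R 2 f"
    and gen: "perp ?R 2 f = {\<Oplus>\<^bsub>?M\<^esub>a\<in>A. c a \<odot>\<^bsub>?M\<^esub> a | c. c \<in> A \<rightarrow> carrier ?R}"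
    unfolding fin_gen_submodule_def by blast
  have AM: "A \<subseteq> carrier ?M" using A(2) perp by blast
  have A1: "a 1 \<in> H" if "a \<in> A" for a
    using AM that multipliers_subset M_carrier by blast
  have axis0: "a 1 (axis p w) = 0" if "a \<in> A" "cmod w < 1" for a w
  proof (rule relation_vanishes_on_axis[OF A1[OF that(1)] pqr that(2)])
    fix z :: "complex ^ 'n" assume "z \<in> ball 0 1"
    moreover have "a 1 z * coord q z + a 2 z * coord r z = 0"
      using that(1) A(2) perp by blast
    ultimately show "a 1 z * z $ q + a 2 z * z $ r = 0" by (simp add: coord_def)
  qed
  have "\<exists>w. cmod w < 1 \<and> (\<forall>a\<in>A. cmod (normal_deriv p r (a 1) w) * sqrt (1 - (cmod w)\<^sup>2) \<le> (1/6) ^ n)" for n :: nat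
    by (rule small_normal_derivs[of "(\<lambda>a. a 1) ` A" p r "(1/6) ^ n"]) (use A A1 pqr in auto)
  then obtain w where w: "\<And>n::nat. cmod (w n) < 1"
    and small: "\<And>n a. a \<in> A \<Longrightarrow> cmod (normal_deriv p r (a 1) (w n)) * sqrt (1 - (cmod (w n))\<^sup>2) \<le> (1/6) ^ n"
    by metis
  have x: "axis p (w n) \<in> ball (0 :: complex ^ 'n) 1" for n using w by (simp add: norm_axis)
  obtain \<alpha> where \<alpha>: "\<And>m. cmod (\<alpha> m) \<le> (1/3) ^ m"
    and large: "\<And>n. cmod (\<Sum>m. \<alpha> m * nkern (axis p (w m)) (axis p (w n))) \<ge> (1/3) ^ n / 2 * nrm (kern (axis p (w n)))"
    by (rule large_kernel_series[of "\<lambda>n. axis p (w n)", OF x kernel_nonzero[OF x]]) (rule that)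
  define h where "h = (\<lambda>z. \<Sum>m. \<alpha> m * nkern (axis p (w m)) z)"
  have h: "h \<in> H" unfolding h_def by (rule kernel_series_mem[OF w \<alpha>])
  have hq: "(\<lambda>z. coord q z * h z) \<in> multipliers H"
    unfolding h_def by (rule coord_kernel_series_multiplier[OF w \<alpha> pqr(1)])
  have hr: "(\<lambda>z. coord r z * h z) \<in> multipliers H"
    unfolding h_def by (rule coord_kernel_series_multiplier[OF w \<alpha> pqr(2)])
  define g where "g = (\<lambda>i\<in>{1..2::nat}. if i = 1 then (\<lambda>z. coord r z * h z) else (\<lambda>z. - (coord q z * h z)))"
  have "g \<in> perp ?R 2 f"
    unfolding perp M_carrier using hr uminus_multiplier[OF hq] by (simp add: g_def)
  then have "\<exists>c. g = (\<Oplus>\<^bsub>?M\<^esub>a\<in>A. c a \<odot>\<^bsub>?M\<^esub> a) \<and> c \<in> A \<rightarrow> carrier ?R"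
    unfolding gen mem_Collect_eq .
  then obtain c where c: "c \<in> A \<rightarrow> carrier ?R" "g = (\<Oplus>\<^bsub>?M\<^esub>a\<in>A. c a \<odot>\<^bsub>?M\<^esub> a)"
    by (elim exE conjE)
  have cM: "c a \<in> multipliers H" if "a \<in> A" for a using c(1) that carrier by auto
  have "(\<lambda>z. coord r z * h z) = g 1" by (simp add: g_def)
  also have "\<dots> = (\<lambda>z. \<Sum>a\<in>A. c a z * a 1 z)"
    unfolding c(2) by (rule finsum_power_module[OF A(1) AM cM]) auto
  finally have eq: "(\<lambda>z. coord r z * h z) = (\<lambda>z. \<Sum>a\<in>A. c a z * a 1 z)" .
  have h_eq: "h (axis p (w n)) = (\<Sum>a\<in>A. c a (axis p (w n)) * normal_deriv p r (a 1) (w n))" for n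
    unfolding normal_deriv_coord_mult[OF h pqr(2) w, symmetric] eq
    by (rule normal_deriv_sum_mult[OF A(1) _ A1 pqr(2) w axis0[OF _ w]]) (use cM multipliers_subset in auto)
  have "\<forall>a\<in>A. \<exists>B. \<forall>z\<in>ball 0 1. cmod (c a z) \<le> B"
  proof
    fix a assume "a \<in> A"
    show "\<exists>B. \<forall>z\<in>ball 0 1. cmod (c a z) \<le> B"
    proof (rule multiplier_bounded[of "c a"])
      show "da_kernel z z \<noteq> 0" if "z \<in> ball 0 1" for z :: "complex ^ 'n"
        by (rule kernel_nonzero[OF that])
      show "(\<lambda>z. c a z * g z) \<in> H" if "g \<in> H" for g
        by (rule multiplier_mem[OF cM[OF \<open>a \<in> A\<close>] that])
    qed blast
  qed
  then obtain B where "\<forall>a\<in>A. \<forall>z\<in>ball 0 1. cmod (c a z) \<le> B a" by (rule bchoice[THEN exE])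
  then have B: "cmod (c a z) \<le> B a" if "a \<in> A" "z \<in> ball 0 1" for a z using that by blast
  have "2 ^ n \<le> 2 * (\<Sum>a\<in>A. B a)" for n
  proof -
    define s where "s = sqrt (1 - (cmod (w n))\<^sup>2)"
    have "(cmod (w n))\<^sup>2 < 1" using w by (simp add: power_less_one_iff)
    then have s: "s > 0" by (simp add: s_def)
    have "nrm (kern (axis p (w n))) = 1 / s"
      using nrm_kern[of "axis p (w n)"] x[of n] by (simp add: s_def norm_axis)
    then have "(1/3) ^ n / 2 * (1 / s) \<le> cmod (h (axis p (w n)))"
      using large[of n] by (simp add: h_def)
    then have "(1/3) ^ n / 2 \<le> cmod (h (axis p (w n))) * s"
      using s by (simp add: pos_divide_le_eq)
    also have "\<dots> \<le> (\<Sum>a\<in>A. cmod (c a (axis p (w n))) * cmod (normal_deriv p r (a 1) (w n))) * s"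
      unfolding h_eq using s by (intro mult_right_mono order_trans[OF norm_sum]) (auto simp: norm_mult)
    also have "\<dots> = (\<Sum>a\<in>A. cmod (c a (axis p (w n))) * (cmod (normal_deriv p r (a 1) (w n)) * s))"
      by (simp add: sum_distrib_right mult.assoc)
    also have "\<dots> \<le> (\<Sum>a\<in>A. B a * (1/6) ^ n)"
    proof (rule sum_mono)
      fix a assume a: "a \<in> A"
      have "0 \<le> B a" using order_trans[OF norm_ge_zero B[OF a x[of n]]] .
      then show "cmod (c a (axis p (w n))) * (cmod (normal_deriv p r (a 1) (w n)) * s) \<le> B a * (1/6) ^ n"
        using B[OF a x[of n]] small[OF a, of n] s unfolding s_def by (intro mult_mono) auto
    qed
    also have "\<dots> = (\<Sum>a\<in>A. B a) * (1/6) ^ n" by (rule sum_distrib_right[symmetric])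
    finally have "(1/3) ^ n / 2 * 6 ^ n \<le> (\<Sum>a\<in>A. B a) * (1/6) ^ n * 6 ^ n"
      by (rule mult_right_mono) simp
    moreover have "(1/6::real) ^ n * 6 ^ n = 1" "(1/3::real) ^ n * 6 ^ n = 2 ^ n"
      by (simp_all add: power_mult_distrib[symmetric])
    ultimately show ?thesis by (simp add: mult.assoc)
  qed
  moreover obtain n where "2 * (\<Sum>a\<in>A. B a) < 2 ^ n"
    using real_arch_pow[of 2] by auto
  ultimately show False by (meson not_less)
qed

lemma not_coherent:
  assumes "CARD('n) \<ge> 3"
  shows "\<not> coherent_ring (multiplier_ring H)"
proof
  assume coh: "coherent_ring (multiplier_ring H)"
  obtain T :: "'n set" where "card T = 3" using obtain_subset_with_card_n[OF assms] by blast
  then obtain p q r :: 'n where pqr: "p \<noteq> q" "p \<noteq> r" "q \<noteq> r" by (auto simp: card_3_iff)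
  let ?f = "\<lambda>i\<in>{1..2::nat}. if i = 1 then coord q else coord r"
  have "?f \<in> carrier (power_module (multiplier_ring H) 2)"
    using coord_multiplier[OF pqr(1)] coord_multiplier[OF pqr(2)]
    by (auto simp: power_module_def multiplier_ring_def)
  then have "fin_gen_submodule (multiplier_ring H) (power_module (multiplier_ring H) 2) (perp (multiplier_ring H) 2 ?f)"
    using coh unfolding coherent_ring_def by (metis one_le_numeral)
  then show False using perp_coord_not_fin_gen[OF pqr] by blast
qed

end

theorem theorem1p2:
  fixes H :: "(complex ^ 'n \<Rightarrow> complex) set"
    and ip :: "(complex ^ 'n \<Rightarrow> complex) \<Rightarrow> (complex ^ 'n \<Rightarrow> complex) \<Rightarrow> complex"
  assumes "CARD('n) \<ge> 3"
    and "drury_arveson H ip"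
  shows "\<not> coherent_ring (multiplier_ring H)"
  using drury_arveson.not_coherent[OF assms(2,1)] .

end
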